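(* Let $\phi=(\phi_1,\dots,\phi_m)$ be any non-dyadic probability distribution on the ordered symbols $s_1\prec\dots\prec s_m$ with $\phi_1,\phi_m>0$. Then one can construct in linear time (i.e. $O(m)$ time) an alphabetic code $C$ for $s_1\prec\dots\prec s_m$ whose average length satisfies $$\mathbb{E}[C]\le H(\phi)+2-\phi_1\bigl(2-\log_2\phi_1-\lceil-\log_2\phi_1\rceil\bigr)-\phi_m\bigl(2-\log_2\phi_m-\lceil-\log_2\phi_m\rceil\bigr)-\sum_{i=1}^{m-1}\min(\phi_i,\phi_{i+1}),$$ and the right-hand side above is strictly smaller than $$H(\phi)+2-\phi_1-\phi_m-\sum_{i=1}^{m-1}\min(\phi_i,\phi_{i+1}).$$
   Context: A (binary) alphabetic code for ordered symbols $s_1\prec\dots\prec s_m$ is a map $w:\{s_1,\dots,s_m\}\to\{0,1\}^+$ that is order preserving with respect to the alphabetical (lexicographic) order on binary strings and prefix-free; equivalently, it is a binary tree with edges labelled $0$ (left) and $1$ (right) whose leaves, read from left to right, are $s_1,\dots,s_m$, the codeword $w(s_i)$ being the sequence of labels on the path from the root to the leaf $s_i$. If $\ell_i$ is the length of $w(s_i)$, the average length of the code $C$ under $\phi$ is $\mathbb{E}[C]=\sum_{i=1}^m\phi_i\ell_i$. $H(\phi)=-\sum_{i=1}^m\phi_i\log_2\phi_i$ is the Shannon entropy (with $0\log_2 0=0$). A probability distribution $\phi=(\phi_1,\dots,\phi_m)$ is dyadic if each $\phi_i$ is equal to $2^{-k_i}$ for a suitable integer $k_i>0$; it is non-dyadic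 if it is not dyadic. Running time counts elementary operations on numbers (arithmetic, comparisons, floors/ceilings, base-2 logarithms, bitwise XOR) at unit cost.
   Formalization: The existence of the code is claimed except when m = 1 or when φ_1 = φ_m = 1/2 (that is, φ = (1/2,0,…,0,1/2)); these are non-dyadic distributions for which no alphabetic code meets the bound. The strict inequality is claimed in all cases. *)

theory Defs
  imports Complex_Main "HOL-Library.Sublist"
begin

section \<open>Distributions\<close>

definition prob_dist :: "nat \<Rightarrow> (nat \<Rightarrow> real) \<Rightarrow> bool" where
  "prob_dist m \<phi> \<longleftrightarrow> (\<forall>i\<in>{1..m}. 0 \<le> \<phi> i) \<and> (\<Sum>i=1..m. \<phi> i) = 1"

text \<open>
  A distribution with a zero entry is never dyadic, and neither is the distribution
  \<open>(1)\<close> on one symbol. The non-dyadic distributions \<open>(1/2, 0, \<dots>, 0, 1/2)\<close> and \<open>(1)\<close> are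
  those for which no alphabetic code with nonempty codewords meets the bound on the average
  length: the bound is 1 for the first ones, where the optimum is 3/2, and -2 for \<open>(1)\<close>.
\<close>

definition dyadic :: "nat \<Rightarrow> (nat \<Rightarrow> real) \<Rightarrow> bool" where
  "dyadic m \<phi> \<longleftrightarrow> (\<forall>i\<in>{1..m}. \<exists>k::nat. k > 0 \<and> \<phi> i = 1 / 2 ^ k)"

text \<open>Here \<open>0 * log 2 0 = 0\<close> holds because multiplication by zero gives zero.\<close>

definition entropy :: "nat \<Rightarrow> (nat \<Rightarrow> real) \<Rightarrow> real" where
  "entropy m \<phi> = - (\<Sum>i=1..m. \<phi> i * log 2 (\<phi> i))"


section \<open>Alphabetic codes\<close>

text \<open>
  A code for \<open>s\<^sub>1, \<dots>, s\<^sub>m\<close> is a map from the indices \<open>1, \<dots>, m\<close> to bit strings,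
  with \<open>False\<close> for the bit 0 and \<open>True\<close> for the bit 1.
\<close>

definition alphabetic_code :: "nat \<Rightarrow> (nat \<Rightarrow> bool list) \<Rightarrow> bool" where
  "alphabetic_code m w \<longleftrightarrow>
     (\<forall>i\<in>{1..m}. w i \<noteq> []) \<and>
     (\<forall>i\<in>{1..m}. \<forall>j\<in>{1..m}. i < j \<longrightarrow> (w i, w j) \<in> lexord {(False, True)}) \<and>
     (\<forall>i\<in>{1..m}. \<forall>j\<in>{1..m}. i \<noteq> j \<longrightarrow> \<not> prefix (w i) (w j))"

definition avg_length :: "nat \<Rightarrow> (nat \<Rightarrow> real) \<Rightarrow> (nat \<Rightarrow> bool list) \<Rightarrow> real" where
  "avg_length m \<phi> w = (\<Sum>i=1..m. \<phi> i * real (length (w i)))"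


section \<open>Unit-cost programs on real numbers\<close>

text \<open>
  Bitwise XOR of real numbers: the integer parts are combined by the XOR of the
  library, the fractional parts bit by bit; the \<open>n\<close>-th bit after the binary point
  of \<open>x\<close> is the parity of \<open>\<lfloor>x * 2 ^ n\<rfloor>\<close>.
\<close>

definition real_xor :: "real \<Rightarrow> real \<Rightarrow> real" where
  "real_xor x y = of_int (xor \<lfloor>x\<rfloor> \<lfloor>y\<rfloor>) +
     (\<Sum>n. if odd \<lfloor>x * 2 ^ Suc n\<rfloor> \<noteq> odd \<lfloor>y * 2 ^ Suc n\<rfloor> then 1 / 2 ^ Suc n else 0)"

lemma real_xor_of_int: "real_xor (of_int a) (of_int b) = of_int (xor a b)"
proof -
  have "\<lfloor>of_int c * 2 ^ Suc n :: real\<rfloor> = c * 2 ^ Suc n" for c :: int and n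
    by (metis floor_of_int of_int_mult of_int_numeral of_int_power)
  then show ?thesis
    by (simp add: real_xor_def)
qed

text \<open>
  The memory consists of named arrays of real numbers, and a scalar variable is the
  entry 0 of an array. An address is rounded down to an integer, a negative one to 0.
  The only literals are integers, so that no information can be hidden in a constant of
  a program. Operations outside their usual domain follow the conventions of HOL.
\<close>

type_synonym state = "string \<Rightarrow> nat \<Rightarrow> real"

definition addr :: "real \<Rightarrow> nat" where
  "addr v = nat \<lfloor>v\<rfloor>"

datatype aexp =
    Num int
  | Read string aexp
  | Add aexp aexp
  | Sub aexp aexp
  | Mul aexp aexp
  | Div aexp aexp
  | Floor aexp
  | Ceil aexp
  | Log2 aexp
  | Xor aexp aexp

datatype bexp =
    Less aexp aexp
  | Equal aexp aexp
  | Not bexp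
  | And bexp bexp

datatype com =
    Skip
  | Write string aexp aexp  \<comment> \<open>array, index, value\<close>
  | Seq com com
  | If bexp com com
  | While bexp com

fun aval :: "aexp \<Rightarrow> state \<Rightarrow> real" where
  "aval (Num c) s = of_int c"
| "aval (Read x e) s = s x (addr (aval e s))"
| "aval (Add a b) s = aval a s + aval b s"
| "aval (Sub a b) s = aval a s - aval b s"
| "aval (Mul a b) s = aval a s * aval b s"
| "aval (Div a b) s = aval a s / aval b s"
| "aval (Floor a) s = of_int \<lfloor>aval a s\<rfloor>"
| "aval (Ceil a) s = of_int \<lceil>aval a s\<rceil>"
| "aval (Log2 a) s = log 2 (aval a s)"
| "aval (Xor a b) s = real_xor (aval a s) (aval b s)"

fun acost :: "aexp \<Rightarrow> nat" where
  "acost (Num c) = 1"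
| "acost (Read x e) = 1 + acost e"
| "acost (Add a b) = 1 + acost a + acost b"
| "acost (Sub a b) = 1 + acost a + acost b"
| "acost (Mul a b) = 1 + acost a + acost b"
| "acost (Div a b) = 1 + acost a + acost b"
| "acost (Floor a) = 1 + acost a"
| "acost (Ceil a) = 1 + acost a"
| "acost (Log2 a) = 1 + acost a"
| "acost (Xor a b) = 1 + acost a + acost b"

fun bval :: "bexp \<Rightarrow> state \<Rightarrow> bool" where
  "bval (Less a b) s \<longleftrightarrow> aval a s < aval b s"
| "bval (Equal a b) s \<longleftrightarrow> aval a s = aval b s"
| "bval (Not b) s \<longleftrightarrow> \<not> bval b s"
| "bval (And b c) s \<longleftrightarrow> bval b s \<and> bval c s"

fun bcost :: "bexp \<Rightarrow> nat" where
  "bcost (Less a b) = 1 + acost a + acost b"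
| "bcost (Equal a b) = 1 + acost a + acost b"
| "bcost (Not b) = 1 + bcost b"
| "bcost (And b c) = 1 + bcost b + bcost c"

text \<open>\<open>exec c s t s'\<close>: the program \<open>c\<close>, started in \<open>s\<close>, halts in \<open>s'\<close> after \<open>t\<close> elementary
  operations.\<close>

inductive exec :: "com \<Rightarrow> state \<Rightarrow> nat \<Rightarrow> state \<Rightarrow> bool" where
  Skip: "exec Skip s 1 s"
| Write: "exec (Write x e a) s (1 + acost e + acost a)
            (s(x := (s x)(addr (aval e s) := aval a s)))"
| Seq: "exec c1 s t1 s' \<Longrightarrow> exec c2 s' t2 s'' \<Longrightarrow> exec (Seq c1 c2) s (t1 + t2) s''"
| IfTrue: "bval b s \<Longrightarrow> exec c1 s t s' \<Longrightarrow> exec (If b c1 c2) s (1 + bcost b + t) s'"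
| IfFalse: "\<not> bval b s \<Longrightarrow> exec c2 s t s' \<Longrightarrow> exec (If b c1 c2) s (1 + bcost b + t) s'"
| WhileFalse: "\<not> bval b s \<Longrightarrow> exec (While b c) s (1 + bcost b) s"
| WhileTrue: "bval b s \<Longrightarrow> exec c s t1 s' \<Longrightarrow> exec (While b c) s' t2 s'' \<Longrightarrow>
                exec (While b c) s (1 + bcost b + t1 + t2) s''"

definition input_state :: "nat \<Rightarrow> (nat \<Rightarrow> real) \<Rightarrow> state" where
  "input_state m \<phi> = (\<lambda>x i.
     if x = ''m'' \<and> i = 0 then real m
     else if x = ''phi'' \<and> i \<in> {1..m} then \<phi> i
     else 0)"

text \<open>
  The codewords of a code may have superlinear total length, so a program outputs the code
  as a binary tree linked by addresses. Node \<open>i \<in> {1..m}\<close> is the leaf \<open>s\<^sub>i\<close>, the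
  addresses above \<open>m\<close> are available for internal nodes, and 0 stands for a missing child.
  The tree represents \<open>w\<close> if, for each \<open>i\<close>, the leaf \<open>s\<^sub>i\<close> is reached from the root by the
  string \<open>w i\<close> and by no other string.
\<close>

definition child :: "state \<Rightarrow> bool \<Rightarrow> nat \<Rightarrow> nat" where
  "child s b u = addr (s (if b then ''right'' else ''left'') u)"

fun reaches :: "nat \<Rightarrow> state \<Rightarrow> nat \<Rightarrow> bool list \<Rightarrow> nat \<Rightarrow> bool" where
  "reaches m s u [] v \<longleftrightarrow> u = v"
| "reaches m s u (b # bs) v \<longleftrightarrow> m < u \<and> reaches m s (child s b u) bs v"

definition represents :: "nat \<Rightarrow> state \<Rightarrow> (nat \<Rightarrow> bool list) \<Rightarrow> bool" where
  "represents m s w \<longleftrightarrow>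
     (\<forall>i\<in>{1..m}. \<forall>bs. reaches m s (addr (s ''root'' 0)) bs i \<longleftrightarrow> bs = w i)"

end

theory Submission
  imports Defs "HOL-Analysis.Convex"
begin

text \<open>
  Give the symbol \<open>i\<close> a dyadic interval, its slot, of length \<open>2\<^sup>-\<^sup>l\<close> with
  \<open>l = \<lceil>- log 2 (\<phi> i)\<rceil>\<close> at the two ends and \<open>l = \<lfloor>- log 2 (\<phi> i)\<rfloor> + 2\<close> in between (arbitrarily
  small for probability 0), so that \<open>\<Sum> \<phi> i * l\<close> is the bound without the minima. A slot
  in the middle is shorter than half of \<open>\<phi> i\<close>, and therefore the slots fit into \<open>[0, 1)\<close> in
  the given order with a gap between any two consecutive ones. In the binary trie of the slots
  each gap is a missing leaf next to \<open>i\<close> or \<open>i + 1\<close>; contracting the nodes with a single child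
  shortens the codeword of one of these two symbols for each gap, which saves
  \<open>min (\<phi> i) (\<phi> (i + 1))\<close>. The contracted trie is the Cartesian tree of the positions of the first
  differing bits of consecutive points of the slots, and a stack builds it in linear time.
\<close>

section \<open>Binary expansions\<close>

lemma floor_double:
  "\<lfloor>2 * (y::real)\<rfloor> = 2 * \<lfloor>y\<rfloor> + (if odd \<lfloor>2 * y\<rfloor> then 1 else 0)"
proof -
  have "2 * \<lfloor>y\<rfloor> \<le> \<lfloor>2 * y\<rfloor>" "\<lfloor>2 * y\<rfloor> \<le> 2 * \<lfloor>y\<rfloor> + 1" by linarith+
  then have "\<lfloor>2 * y\<rfloor> = 2 * \<lfloor>y\<rfloor> \<or> \<lfloor>2 * y\<rfloor> = 2 * \<lfloor>y\<rfloor> + 1" by linarith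
  then show ?thesis by auto
qed

lemma floor_next_digit:
  "\<lfloor>(x::real) * 2 ^ Suc n\<rfloor> = 2 * \<lfloor>x * 2 ^ n\<rfloor> + (if odd \<lfloor>x * 2 ^ Suc n\<rfloor> then 1 else 0)"
proof -
  have "2 * (x * 2 ^ n) = x * 2 ^ Suc n" by simp
  then show ?thesis using floor_double[of "x * 2 ^ n"] by metis
qed

lemma binary_digits_sum:
  assumes "0 \<le> x" "x < (1::real)"
  shows "(\<Sum>n<N. of_bool (odd \<lfloor>x * 2 ^ Suc n\<rfloor>) / 2 ^ Suc n) = of_int \<lfloor>x * 2 ^ N\<rfloor> / (2 ^ N :: real)"
proof (induction N)
  case 0
  have "\<lfloor>x\<rfloor> = 0" using assms by linarith
  then show ?case by simp
next
  case (Suc N)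
  define f where "f n = \<lfloor>x * 2 ^ n\<rfloor>" for n
  have "f (Suc N) = 2 * f N + of_bool (odd (f (Suc N)))"
    unfolding of_bool_def f_def by (rule floor_next_digit)
  then have "real_of_int (f (Suc N)) = of_int (2 * f N + of_bool (odd (f (Suc N))))"
    by (rule arg_cong)
  then have "real_of_int (f (Suc N)) = 2 * of_int (f N) + of_bool (odd (f (Suc N)))"
    by (simp only: of_int_add of_int_mult of_int_numeral of_int_of_bool)
  with Suc[folded f_def] show ?case
    unfolding f_def[symmetric] by (simp add: field_simps)
qed

text \<open>The partial sums are truncations of \<open>x\<close> and so lie within 2^-N below
  it.\<close>

lemma binary_digits_sums:
  assumes "0 \<le> x" "x < (1::real)"
  shows "(\<lambda>n. of_bool (odd \<lfloor>x * 2 ^ Suc n\<rfloor>) / 2 ^ Suc n) sums x"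
  unfolding sums_def
proof (rule tendsto_sandwich)
  show "\<forall>\<^sub>F N in sequentially. x - (1/2) ^ N \<le> (\<Sum>n<N. of_bool (odd \<lfloor>x * 2 ^ Suc n\<rfloor>) / 2 ^ Suc n)"
  proof (rule always_eventually, rule allI)
    fix N
    have "x * 2 ^ N - 1 \<le> of_int \<lfloor>x * 2 ^ N\<rfloor>" by linarith
    then show "x - (1/2) ^ N \<le> (\<Sum>n<N. of_bool (odd \<lfloor>x * 2 ^ Suc n\<rfloor>) / 2 ^ Suc n)"
      unfolding binary_digits_sum[OF assms] by (simp add: pos_le_divide_eq left_diff_distrib power_one_over)
  qed
  show "\<forall>\<^sub>F N in sequentially. (\<Sum>n<N. of_bool (odd \<lfloor>x * 2 ^ Suc n\<rfloor>) / 2 ^ Suc n) \<le> x"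
    unfolding binary_digits_sum[OF assms] by (simp add: pos_divide_le_eq)
  have "(\<lambda>N. (1/2::real) ^ N) \<longlonglongrightarrow> 0" by (rule LIMSEQ_power_zero) simp
  from tendsto_diff[OF tendsto_const this, of x] show "(\<lambda>N. x - (1/2) ^ N) \<longlonglongrightarrow> x" by simp
qed simp

text \<open>Dropping digits is integer division, so two points that agree at depth \<open>d\<close>
  agree at every smaller depth.\<close>

lemma floor_coarsen:
  assumes "n \<le> d"
  shows "\<lfloor>x * 2 ^ n\<rfloor> = \<lfloor>(x::real) * 2 ^ d\<rfloor> div 2 ^ (d - n)"
proof -
  have "x * 2 ^ n = x * 2 ^ d / real_of_int (2 ^ (d - n))"
    using assms by (simp flip: power_add add: nonzero_eq_divide_eq mult.assoc)
  also have "\<lfloor>\<dots>\<rfloor> = \<lfloor>x * 2 ^ d\<rfloor> div 2 ^ (d - n)"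
    by (rule floor_divide_real_eq_div) simp
  finally show ?thesis .
qed

section \<open>First differing binary digits and their computation by XOR\<close>

definition first_diff :: "real \<Rightarrow> real \<Rightarrow> nat" where
  "first_diff x y = (LEAST n. \<lfloor>x * 2 ^ n\<rfloor> \<noteq> \<lfloor>y * 2 ^ n\<rfloor>)"

lemma first_diff_less: "d < first_diff x y \<Longrightarrow> \<lfloor>x * 2 ^ d\<rfloor> = \<lfloor>y * 2 ^ d\<rfloor>"
  unfolding first_diff_def using not_less_Least by blast

text \<open>The floors differ as soon as the scaled distance exceeds 1, so the least index exists;
  monotonicity of the floor gives the direction.\<close>

lemma first_diff:
  assumes "x < y"
  shows "\<lfloor>x * 2 ^ first_diff x y\<rfloor> < \<lfloor>y * 2 ^ first_diff x y\<rfloor>"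
proof -
  obtain n where "1 / (y - x) < 2 ^ n" using real_arch_pow[of 2 "1 / (y - x)"] by auto
  then have "x * 2 ^ n + 1 < y * 2 ^ n" using assms by (simp add: field_simps)
  then have "\<lfloor>x * 2 ^ n\<rfloor> \<noteq> \<lfloor>y * 2 ^ n\<rfloor>" by linarith
  then have "\<lfloor>x * 2 ^ first_diff x y\<rfloor> \<noteq> \<lfloor>y * 2 ^ first_diff x y\<rfloor>"
    unfolding first_diff_def by (rule LeastI)
  moreover have "\<lfloor>x * 2 ^ first_diff x y\<rfloor> \<le> \<lfloor>y * 2 ^ first_diff x y\<rfloor>"
    using assms by (intro floor_mono) simp
  ultimately show ?thesis by simp
qed

lemma first_diff_pos:
  assumes "0 \<le> x" "x < y" "y < 1"
  shows "0 < first_diff x y"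
proof (rule ccontr)
  assume "\<not> ?thesis"
  then have "\<lfloor>x\<rfloor> < \<lfloor>y\<rfloor>" using first_diff[OF assms(2)] by simp
  moreover have "\<lfloor>x\<rfloor> = 0" "\<lfloor>y\<rfloor> = 0" using assms by linarith+
  ultimately show False by simp
qed

definition split_key :: "real \<Rightarrow> real \<Rightarrow> int" where
  "split_key x y = \<lfloor>log 2 ((real_xor x y + (y - x)) / 2)\<rfloor>"

text \<open>Half of \<open>xor x y + (y - x)\<close> collects the digits that are 1 in \<open>y\<close> and 0 in \<open>x\<close>. The value of
  the XOR itself does not determine its leading digit, since the digits of the XOR may end in
  ones only: the XOR of 1/3 and 2/3 is 1.\<close>

lemma split_key_eq:
  assumes "0 \<le> x" "x < y" "y < 1"
  shows "split_key x y = - int (first_diff x y)"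
proof -
  define n where "n = first_diff x y"
  let ?b = "\<lambda>x k. of_bool (odd \<lfloor>x * 2 ^ Suc k\<rfloor>) :: real"
  let ?d = "\<lambda>k. if odd \<lfloor>x * 2 ^ Suc k\<rfloor> \<noteq> odd \<lfloor>y * 2 ^ Suc k\<rfloor> then 1 / 2 ^ Suc k else (0::real)"
  let ?v = "\<lambda>k. of_bool (odd \<lfloor>y * 2 ^ Suc k\<rfloor> \<and> even \<lfloor>x * 2 ^ Suc k\<rfloor>) / (2 ^ Suc k :: real)"
  have n0: "0 < n" unfolding n_def by (rule first_diff_pos[OF assms])
  then obtain q where q: "n = Suc q" by (cases n) auto
  have below: "\<lfloor>x * 2 ^ d\<rfloor> = \<lfloor>y * 2 ^ d\<rfloor>" if "d < n" for d
    using that unfolding n_def by (rule first_diff_less)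
  have at: "\<lfloor>x * 2 ^ n\<rfloor> < \<lfloor>y * 2 ^ n\<rfloor>" unfolding n_def by (rule first_diff[OF assms(2)])
  have dx: "\<lfloor>x * 2 ^ n\<rfloor> = 2 * \<lfloor>x * 2 ^ q\<rfloor> + (if odd \<lfloor>x * 2 ^ n\<rfloor> then 1 else 0)"
    and dy: "\<lfloor>y * 2 ^ n\<rfloor> = 2 * \<lfloor>y * 2 ^ q\<rfloor> + (if odd \<lfloor>y * 2 ^ n\<rfloor> then 1 else 0)"
    unfolding q by (rule floor_next_digit)+
  \<comment> \<open>The points agree at depth \<open>q\<close>, so at depth \<open>n\<close> only
    the last digit differs, and the larger point has the 1.\<close>
  have par: "even \<lfloor>x * 2 ^ n\<rfloor>" "odd \<lfloor>y * 2 ^ n\<rfloor>"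
    using dx dy at below[of q] unfolding q by (auto split: if_splits)
  have geo: "(\<lambda>k. (1/2::real) ^ Suc k) sums 1"
    using power_half_series by simp
  have sd: "summable ?d"
    by (rule summable_comparison_test'[OF sums_summable[OF geo], of 0]) (simp add: field_simps)
  have xor: "real_xor x y = suminf ?d"
  proof -
    have "\<lfloor>x\<rfloor> = 0" "\<lfloor>y\<rfloor> = 0" using assms by linarith+
    then show ?thesis by (simp add: real_xor_def)
  qed
  have "(\<lambda>k. (?d k + (?b y k / 2 ^ Suc k - ?b x k / 2 ^ Suc k)) / 2) sums ((real_xor x y + (y - x)) / 2)"
    unfolding xor using assms
    by (intro sums_divide sums_add sums_diff summable_sums[OF sd] binary_digits_sums) auto
  also have "(\<lambda>k. (?d k + (?b y k / 2 ^ Suc k - ?b x k / 2 ^ Suc k)) / 2) = ?v"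
    by (rule ext) (auto simp: field_simps)
  finally have sv: "?v sums ((real_xor x y + (y - x)) / 2)" (is "_ sums ?V") .
  \<comment> \<open>The digit at depth \<open>n\<close> alone contributes 2^-n.\<close>
  have "sum ?v {q} \<le> suminf ?v"
    by (rule sum_le_suminf) (use sv in \<open>auto simp: sums_iff\<close>)
  then have lo: "1 / 2 ^ n \<le> ?V"
    using par sv q by (simp add: sums_iff)
  have z: "?d k = 0" if "k < q" for k
    using below[of "Suc k"] that q by simp
  have "suminf ?d = (\<Sum>k. ?d (k + q)) + (\<Sum>k<q. ?d k)"
    by (rule suminf_split_initial_segment[OF sd])
  also have "(\<Sum>k<q. ?d k) = 0" by (rule sum.neutral) (use z in auto)
  also have "(\<Sum>k. ?d (k + q)) \<le> (\<Sum>k. (1/2) ^ Suc k * (1/2) ^ q)"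
  proof (rule suminf_le)
    show "?d (k + q) \<le> (1/2) ^ Suc k * (1/2) ^ q" for k
      by (simp add: power_add power_one_over)
    show "summable (\<lambda>k. ?d (k + q))" using sd by (rule summable_ignore_initial_segment)
    show "summable (\<lambda>k. (1/2::real) ^ Suc k * (1/2) ^ q)"
      by (rule summable_mult2[OF sums_summable[OF geo]])
  qed
  also have "\<dots> = (1/2) ^ q"
    using sums_mult2[OF geo, of "(1/2) ^ q"] by (simp add: sums_iff)
  finally have u: "real_xor x y \<le> (1/2) ^ q" by (simp add: xor)
  \<comment> \<open>The bound on the XOR can be attained, as for 1/3 and 2/3; the strict bound on
    the difference makes the mean of the two strict.\<close>
  have "y * 2 ^ q - x * 2 ^ q < 1" using below[of q] q by linarith
  then have "y - x < (1/2) ^ q" by (simp add: field_simps)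
  with u have hi: "?V < (1/2) ^ q" by simp
  have pos: "0 < ?V" by (rule less_le_trans[OF _ lo]) simp
  have "- real n \<le> log 2 ?V"
  proof -
    have "log 2 (1 / 2 ^ n) \<le> log 2 ?V" using lo pos by (subst log_le_cancel_iff) auto
    then show ?thesis by (simp add: log_divide)
  qed
  moreover have "log 2 ?V < - real q"
  proof -
    have "log 2 ?V < log 2 (1 / 2 ^ q)" using hi pos by (subst log_less_cancel_iff) (auto simp: power_one_over)
    then show ?thesis by (simp add: log_divide)
  qed
  ultimately have "\<lfloor>log 2 ?V\<rfloor> = - int n" unfolding q by (intro floor_unique) auto
  then show ?thesis unfolding split_key_def n_def .
qed

section \<open>Cartesian trees\<close>

text \<open>\<open>Node j L R\<close> separates the leaves up to \<open>j\<close> from the leaves after \<open>j\<close>.\<close>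

datatype tree = Leaf nat | Node nat tree tree

fun codeword :: "tree \<Rightarrow> nat \<Rightarrow> bool list" where
  "codeword (Leaf j) i = []"
| "codeword (Node j L R) i = (if i \<le> j then False # codeword L i else True # codeword R i)"

text \<open>Gap \<open>g\<close> lies between the leaves \<open>g\<close> and \<open>Suc g\<close>.
  Keys will be negated depths, so a maximal key marks the shallowest branching; ties may be broken
  either way.\<close>

fun cartesian :: "(nat \<Rightarrow> int) \<Rightarrow> tree \<Rightarrow> nat \<Rightarrow> nat \<Rightarrow> bool" where
  "cartesian K (Leaf j) l r \<longleftrightarrow> l = j \<and> r = j"
| "cartesian K (Node j L R) l r \<longleftrightarrow>
     cartesian K L l j \<and> cartesian K R (Suc j) r \<and> (\<forall>g\<in>{l..<r}. K g \<le> K j)"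

lemma cartesian_le: "cartesian K T l r \<Longrightarrow> l \<le> r"
  by (induction T arbitrary: l r) fastforce+

lemma cartesian_Node_bounds:
  assumes "cartesian K (Node j L R) l r"
  shows "l \<le> j" "j < r"
  using assms cartesian_le[of K L l j] cartesian_le[of K R "Suc j" r] by auto

lemma codeword_lexord:
  assumes "cartesian K T l r" "l \<le> i" "i < j" "j \<le> r"
  shows "(codeword T i, codeword T j) \<in> lexord {(False, True)}"
  using assms
proof (induction T arbitrary: l r)
  case (Node k L R)
  show ?case
  proof (cases "j \<le> k")
    case True
    then show ?thesis using Node.IH(1)[of l k] Node.prems by auto
  next
    case False
    then show ?thesis using Node.IH(2)[of "Suc k" r] Node.prems by auto
  qed
qed simp

lemma codeword_not_prefix:
  assumes "cartesian K T l r" "i \<in> {l..r}" "j \<in> {l..r}" "i \<noteq> j"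
  shows "\<not> prefix (codeword T i) (codeword T j)"
  using assms
proof (induction T arbitrary: l r)
  case (Node k L R)
  show ?case
    using Node.IH(1)[of l k] Node.IH(2)[of "Suc k" r] Node.prems by auto
qed simp

text \<open>Two leaves force an internal root, hence nonempty codewords.\<close>

lemma alphabetic_code_codeword:
  assumes "cartesian K T 1 m" "2 \<le> m"
  shows "alphabetic_code m (codeword T)"
proof -
  obtain j L R where T: "T = Node j L R" using assms by (cases T) auto
  have "codeword T i \<noteq> []" for i by (simp add: T)
  then show ?thesis
    unfolding alphabetic_code_def
    using codeword_lexord[OF assms(1)] codeword_not_prefix[OF assms(1)] by auto
qed

section \<open>The average length of a Cartesian tree\<close>

text \<open>The symbol \<open>i\<close> occupies the dyadic interval of length \<open>2\<^sup>-\<^sup>\<ell>\<^sup>i\<close> around \<open>x i\<close>, which starts at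
  \<open>slot_start\<close> and ends at \<open>slot_end\<close>.\<close>

definition slot_start :: "real \<Rightarrow> nat \<Rightarrow> real" where
  "slot_start x n = of_int \<lfloor>x * 2 ^ n\<rfloor> / 2 ^ n"

definition slot_end :: "real \<Rightarrow> nat \<Rightarrow> real" where
  "slot_end x n = of_int (\<lfloor>x * 2 ^ n\<rfloor> + 1) / 2 ^ n"

lemma slot_start_le: "slot_start x n \<le> x"
  by (simp add: slot_start_def pos_divide_le_eq)

lemma less_slot_end: "x < slot_end x n"
  by (simp add: slot_end_def pos_less_divide_eq)

lemma slot_cong:
  assumes "\<lfloor>x * 2 ^ n\<rfloor> = \<lfloor>y * 2 ^ n\<rfloor>"
  shows "slot_start x n = slot_start y n" "slot_end x n = slot_end y n"
  using assms by (simp_all add: slot_start_def slot_end_def)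

text \<open>The only case that needs the dyadic structure is \<open>n = d + 1\<close>: a half of an interval shares an end with it.\<close>

lemma slot_free_ends:
  assumes "d \<le> n" "0 \<le> (w::real)"
  shows "(if slot_start x d < slot_start x n then w else 0) +
         (if slot_end x n < slot_end x d then w else 0) \<le> w * (real n - real d)"
proof (cases "n = d")
  case False
  show ?thesis
  proof (cases "n = Suc d")
    case True
    have "slot_start x d = slot_start x n \<or> slot_end x n = slot_end x d"
      using floor_next_digit[of x d] unfolding True slot_start_def slot_end_def
      by (cases "odd \<lfloor>x * 2 ^ Suc d\<rfloor>") (simp_all add: add_divide_distrib)
    then show ?thesis using assms(2) True by auto
  next
    assume "n \<noteq> Suc d"
    then have "real n - real d \<ge> 2" using False assms(1) by linarith
    then have "w * 2 \<le> w * (real n - real d)" by (rule mult_left_mono) (rule assms(2))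
    then show ?thesis using assms(2) by (smt (verit))
  qed
qed simp

text \<open>The cost estimate does not depend on how points and lengths are found, only on the
  strict gaps between the slots.\<close>

locale separated_points =
  fixes m :: nat and x \<phi> :: "nat \<Rightarrow> real" and len :: "nat \<Rightarrow> nat" and K :: "nat \<Rightarrow> int"
  assumes gap: "i \<in> {1..<m} \<Longrightarrow> slot_end (x i) (len i) < slot_start (x (Suc i)) (len (Suc i))"
    and K: "i \<in> {1..<m} \<Longrightarrow> K i = - int (first_diff (x i) (x (Suc i)))"
    and nonneg: "i \<in> {1..m} \<Longrightarrow> 0 \<le> \<phi> i"
begin

lemma x_less: "i \<in> {1..<m} \<Longrightarrow> x i < x (Suc i)"
  using gap[of i] less_slot_end[of "x i" "len i"] slot_start_le[of "x (Suc i)" "len (Suc i)"] by linarith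

lemma x_mono:
  assumes "1 \<le> i" "i \<le> j" "j \<le> m"
  shows "x i \<le> x j"
  using assms(2,3)
proof (induction j rule: dec_induct)
  case (step j)
  then show ?case using x_less[of j] assms(1) by simp
qed simp

lemma common_prefix:
  assumes "1 \<le> l" "r \<le> m" "\<And>g. g \<in> {l..<r} \<Longrightarrow> d < first_diff (x g) (x (Suc g))" "i \<in> {l..r}"
  shows "\<lfloor>x i * 2 ^ d\<rfloor> = \<lfloor>x l * 2 ^ d\<rfloor>"
proof -
  have "l \<le> i" "i \<le> r" using assms(4) by auto
  then show ?thesis
  proof (induction i rule: dec_induct)
    case (step i)
    then show ?case using assms(3)[of i] first_diff_less[of d "x i" "x (Suc i)"] by simp
  qed simp
qed

text \<open>A slot of depth at most \<open>d\<close> would contain the whole common interval of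
  depth \<open>d\<close>, and with it the point of a neighbour, across the gap between the two
  slots.\<close>

lemma slot_smaller:
  assumes "1 \<le> l" "l < r" "r \<le> m" "i \<in> {l..r}"
    and same: "\<And>j. j \<in> {l..r} \<Longrightarrow> \<lfloor>x j * 2 ^ d\<rfloor> = p"
  shows "d < len i"
proof (rule ccontr)
  assume "\<not> ?thesis"
  then have le: "len i \<le> d" by simp
  have eq: "\<lfloor>x j * 2 ^ len i\<rfloor> = \<lfloor>x i * 2 ^ len i\<rfloor>" if "j \<in> {l..r}" for j
    using that assms(4) by (simp add: floor_coarsen[OF le] same)
  show False
  proof (cases "i < r")
    case True
    then have "slot_end (x (Suc i)) (len i) = slot_end (x i) (len i)"
      using assms(4) by (intro slot_cong eq) auto
    moreover have "x (Suc i) < slot_end (x (Suc i)) (len i)" by (rule less_slot_end)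
    moreover have "slot_end (x i) (len i) < slot_start (x (Suc i)) (len (Suc i))"
      using assms True by (intro gap) auto
    moreover have "slot_start (x (Suc i)) (len (Suc i)) \<le> x (Suc i)" by (rule slot_start_le)
    ultimately show False by linarith
  next
    case False
    then obtain j where j: "i = Suc j" "j \<in> {l..r}" "j \<in> {1..<m}" using assms by (cases i) auto
    then have "slot_start (x j) (len i) = slot_start (x i) (len i)"
      by (intro slot_cong eq) auto
    moreover have "slot_start (x j) (len i) \<le> x j" by (rule slot_start_le)
    moreover have "slot_end (x j) (len j) < slot_start (x i) (len i)" using gap[of j] j by simp
    moreover have "x j < slot_end (x j) (len j)" by (rule less_slot_end)
    ultimately show False by linarith
  qed
qed

text \<open>Costs are counted relative to an interval of depth \<open>d\<close> around all the
  points, where the uncontracted trie needs \<open>len i - d\<close> digits. The two conditional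
  terms strengthen the induction: free space at either end of the interval is saved on top of the
  minima, and at the parent node such savings pay for the minimum at the middle gap.\<close>

lemma cost_in_interval:
  assumes "cartesian K T l r" "1 \<le> l" "r \<le> m"
    and "\<And>i. i \<in> {l..r} \<Longrightarrow> \<lfloor>x i * 2 ^ d\<rfloor> = p"
    and "\<And>i. i \<in> {l..r} \<Longrightarrow> d \<le> len i"
  shows "(\<Sum>i=l..r. \<phi> i * length (codeword T i))
          + (if slot_start (x l) d < slot_start (x l) (len l) then \<phi> l else 0)
          + (if slot_end (x r) (len r) < slot_end (x r) d then \<phi> r else 0)
         \<le> (\<Sum>i=l..r. \<phi> i * (real (len i) - d)) - (\<Sum>i=l..<r. min (\<phi> i) (\<phi> (Suc i)))"
  using assms
proof (induction T arbitrary: l r d p)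
  case (Leaf i)
  then have i: "l = i" "r = i" "d \<le> len i" "0 \<le> \<phi> i" using nonneg[of i] by auto
  have "(\<Sum>k=i..i. \<phi> k * length (codeword (Leaf i) k)) = 0" "(\<Sum>k=i..<i. min (\<phi> k) (\<phi> (Suc k))) = 0"
    "(\<Sum>k=i..i. \<phi> k * (real (len k) - d)) = \<phi> i * (real (len i) - d)" by simp_all
  \<comment> \<open>A single leaf is contracted to length 0; \<open>slot_free_ends\<close> pays for
    both ends.\<close>
  then show ?case
    unfolding i(1,2) using slot_free_ends[OF i(3,4), of "x i"] by linarith
next
  case (Node j L R)
  have L: "cartesian K L l j" and R: "cartesian K R (Suc j) r"
    and top: "\<And>g. g \<in> {l..<r} \<Longrightarrow> K g \<le> K j" using Node.prems(1) by auto
  have j: "l \<le> j" "j < r" using cartesian_Node_bounds[OF Node.prems(1)] by auto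
  note lr = Node.prems(2,3)
  define n where "n = first_diff (x j) (x (Suc j))"
  have xj: "x j < x (Suc j)" using x_less[of j] j lr by simp
  \<comment> \<open>The largest key is the smallest separating depth: all points share their first
    \<open>n - 1\<close> digits and split at digit \<open>n\<close>.\<close>
  have nmin: "n \<le> first_diff (x g) (x (Suc g))" if "g \<in> {l..<r}" for g
    using top[OF that] that K[of g] K[of j] j lr unfolding n_def by simp
  have diff: "\<lfloor>x j * 2 ^ n\<rfloor> < \<lfloor>x (Suc j) * 2 ^ n\<rfloor>" unfolding n_def by (rule first_diff[OF xj])
  have "d < n"
  proof (rule ccontr)
    assume "\<not> d < n"
    then have "\<lfloor>x j * 2 ^ n\<rfloor> = \<lfloor>x (Suc j) * 2 ^ n\<rfloor>"
      using Node.prems(4)[of j] Node.prems(4)[of "Suc j"] j by (simp add: floor_coarsen[of n d])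
    then show False using diff by simp
  qed
  then obtain q where q: "n = Suc q" "d \<le> q" by (cases n) auto
  define c where "c = \<lfloor>x l * 2 ^ q\<rfloor>"
  have pre: "\<lfloor>x i * 2 ^ q\<rfloor> = c" if "i \<in> {l..r}" for i
    unfolding c_def using nmin q that lr by (intro common_prefix[of l r]) (auto simp: Suc_le_eq)
  \<comment> \<open>The halves of the interval of depth \<open>q\<close> have the numbers
    \<open>2 * c\<close> and \<open>2 * c + 1\<close>; by monotonicity the points up to
    \<open>j\<close> lie in the left one and the others in the right one.\<close>
  have dig: "\<lfloor>x i * 2 ^ n\<rfloor> = 2 * c \<or> \<lfloor>x i * 2 ^ n\<rfloor> = 2 * c + 1" if "i \<in> {l..r}" for i
    using floor_next_digit[of "x i" q] pre[OF that] unfolding q by (auto split: if_splits)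
  have dj: "\<lfloor>x j * 2 ^ n\<rfloor> = 2 * c" "\<lfloor>x (Suc j) * 2 ^ n\<rfloor> = 2 * c + 1"
    using dig[of j] dig[of "Suc j"] diff j by auto
  have dl: "\<lfloor>x i * 2 ^ n\<rfloor> = 2 * c" if "i \<in> {l..j}" for i
  proof -
    have "\<lfloor>x i * 2 ^ n\<rfloor> \<le> \<lfloor>x j * 2 ^ n\<rfloor>"
      using x_mono[of i j] that j lr by (intro floor_mono) simp
    then show ?thesis using dig[of i] dj that j by auto
  qed
  have dr: "\<lfloor>x i * 2 ^ n\<rfloor> = 2 * c + 1" if "i \<in> {Suc j..r}" for i
  proof -
    have "\<lfloor>x (Suc j) * 2 ^ n\<rfloor> \<le> \<lfloor>x i * 2 ^ n\<rfloor>"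
      using x_mono[of "Suc j" i] that j lr by (intro floor_mono) simp
    then show ?thesis using dig[of i] dj that j by auto
  qed
  have len: "n \<le> len i" if "i \<in> {l..r}" for i
    using slot_smaller[of l r i q c] pre that j lr q by auto
  define A where "A i = \<phi> i * real (length (codeword L i))" for i
  define B where "B i = \<phi> i * real (length (codeword R i))" for i
  define M where "M i = min (\<phi> i) (\<phi> (Suc i))" for i
  define W where "W i = \<phi> i * (real (len i) - n)" for i
  have split: "sum f {l..r} = sum f {l..j} + sum f {Suc j..r}" for f :: "nat \<Rightarrow> real"
    using j by (metis le_Suc_eq less_imp_le_nat sum.ub_add_nat add_diff_inverse_nat le_add_diff_inverse Suc_eq_plus1)
  have splitM: "sum M {l..<r} = sum M {l..<j} + M j + sum M {Suc j..<r}"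
    using j by (metis sum.atLeastLessThan_concat sum.atLeast_Suc_lessThan less_imp_le_nat add.assoc)
  have IHL: "sum A {l..j}
          + (if slot_start (x l) n < slot_start (x l) (len l) then \<phi> l else 0)
          + (if slot_end (x j) (len j) < slot_end (x j) n then \<phi> j else 0)
         \<le> sum W {l..j} - sum M {l..<j}"
    unfolding A_def M_def W_def using j lr len by (intro Node.IH(1)[OF L, of n "2 * c"] dl) auto
  have IHR: "sum B {Suc j..r}
          + (if slot_start (x (Suc j)) n < slot_start (x (Suc j)) (len (Suc j)) then \<phi> (Suc j) else 0)
          + (if slot_end (x r) (len r) < slot_end (x r) n then \<phi> r else 0)
         \<le> sum W {Suc j..r} - sum M {Suc j..<r}"
    unfolding B_def M_def W_def using j lr len by (intro Node.IH(2)[OF R, of n "2 * c + 1"] dr) auto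
  have nn: "0 \<le> \<phi> i" if "i \<in> {l..r}" for i using nonneg[of i] that lr by auto
  \<comment> \<open>The halves meet at the midpoint. Since the slots of \<open>j\<close> and
    \<open>Suc j\<close> do not touch, at least one of them stays away from it, and its probability
    is at least the minimum.\<close>
  have mid: "M j \<le> (if slot_end (x j) (len j) < slot_end (x j) n then \<phi> j else 0)
      + (if slot_start (x (Suc j)) n < slot_start (x (Suc j)) (len (Suc j)) then \<phi> (Suc j) else 0)"
  proof -
    have "slot_end (x j) n = slot_start (x (Suc j)) n"
      by (simp add: slot_start_def slot_end_def dj)
    moreover have "slot_end (x j) (len j) < slot_start (x (Suc j)) (len (Suc j))"
      using j lr by (intro gap) auto
    moreover have "0 \<le> \<phi> j" "0 \<le> \<phi> (Suc j)" using nn j by auto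
    ultimately show ?thesis unfolding M_def by auto
  qed
  \<comment> \<open>The outer ends of the halves are those of the interval of depth
    \<open>q\<close>.\<close>
  have ends: "slot_start (x l) n = slot_start (x l) q" "slot_end (x r) n = slot_end (x r) q"
    using dl[of l] pre[of l] dr[of r] pre[of r] j unfolding q slot_start_def slot_end_def
    by (auto simp: add_divide_distrib)
  have sumA: "(\<Sum>i=l..j. \<phi> i * length (codeword (Node j L R) i)) = sum A {l..j} + sum \<phi> {l..j}"
    unfolding A_def sum.distrib[symmetric] by (intro sum.cong) (auto simp: algebra_simps)
  have sumB: "(\<Sum>i=Suc j..r. \<phi> i * length (codeword (Node j L R) i)) = sum B {Suc j..r} + sum \<phi> {Suc j..r}"
    unfolding B_def sum.distrib[symmetric] by (intro sum.cong) (auto simp: algebra_simps)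
  \<comment> \<open>Descending from depth \<open>d\<close> to \<open>n\<close> passes
    \<open>n - d\<close> levels, of which the tree keeps one.\<close>
  have W: "(\<Sum>i=l..r. \<phi> i * (real (len i) - d)) = sum W {l..r} + (real n - d) * sum \<phi> {l..r}"
    unfolding W_def sum_distrib_left sum.distrib[symmetric] by (intro sum.cong) (auto simp: algebra_simps)
  define S where "S = sum \<phi> {l..r}"
  have two: "\<phi> l + \<phi> r \<le> S"
  proof -
    have "sum \<phi> {l, r} \<le> S" unfolding S_def using j nn by (intro sum_mono2) auto
    then show ?thesis using j by simp
  qed
  \<comment> \<open>If \<open>d = q\<close>, no level is contracted and the free ends are inherited.
    Otherwise a contracted level saves \<open>S\<close>, which pays for both ends at once.\<close>
  have crude: "(if slot_start (x l) d < slot_start (x l) (len l) then \<phi> l else 0)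
          + (if slot_end (x r) (len r) < slot_end (x r) d then \<phi> r else 0)
      \<le> (real n - d) * S - S
          + (if slot_start (x l) n < slot_start (x l) (len l) then \<phi> l else 0)
          + (if slot_end (x r) (len r) < slot_end (x r) n then \<phi> r else 0)"
  proof (cases "d = q")
    case True
    then show ?thesis using ends q by (simp add: algebra_simps)
  next
    case False
    have nl: "0 \<le> \<phi> l" "0 \<le> \<phi> r" using nn j by auto
    have "2 \<le> real n - d" using False q by linarith
    then have "2 * S \<le> (real n - d) * S" using two nl by (intro mult_right_mono) auto
    then show ?thesis using two nl by auto
  qed
  show ?case
    unfolding split[of "\<lambda>i. \<phi> i * length (codeword (Node j L R) i)"] sumA sumB W M_def[symmetric] splitM S_def[symmetric]
    using IHL IHR mid crude split[of W] split[of \<phi>, folded S_def] by linarith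
qed

text \<open>The estimate for the unit interval, \<open>d = 0\<close>, without the savings at its two
  ends.\<close>

lemma avg_length_cartesian:
  assumes "cartesian K T 1 m" and x01: "\<And>i. i \<in> {1..m} \<Longrightarrow> 0 \<le> x i \<and> x i < 1"
  shows "avg_length m \<phi> (codeword T) \<le> (\<Sum>i=1..m. \<phi> i * len i) - (\<Sum>i=1..m-1. min (\<phi> i) (\<phi> (i + 1)))"
proof -
  have m: "1 \<le> m" using cartesian_le[OF assms(1)] .
  have "\<lfloor>x i * 2 ^ 0\<rfloor> = 0" if "i \<in> {1..m}" for i using x01[OF that] by (simp add: floor_eq_iff)
  from cost_in_interval[OF assms(1) _ _ this]
  have "avg_length m \<phi> (codeword T)
      + (if slot_start (x 1) 0 < slot_start (x 1) (len 1) then \<phi> 1 else 0)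
      + (if slot_end (x m) (len m) < slot_end (x m) 0 then \<phi> m else 0)
    \<le> (\<Sum>i=1..m. \<phi> i * len i) - (\<Sum>i=1..<m. min (\<phi> i) (\<phi> (Suc i)))"
    unfolding avg_length_def by simp
  moreover have "0 \<le> \<phi> 1" "0 \<le> \<phi> m" using nonneg m by auto
  moreover have "{1..<m} = {1..m-1}" by auto
  ultimately show ?thesis by (auto split: if_splits)
qed

end

section \<open>Weights and points\<close>

text \<open>The weight of a symbol is an upper bound for the width of its slot, computed without
  powers of 2: replacing the convex function \<open>2\<^sup>-\<^sup>t\<close> on \<open>[0, 1]\<close> by its chord \<open>1 - t / 2\<close>
  keeps the weight below the probability.\<close>

lemma powr_le_chord:
  assumes "0 \<le> t" "t \<le> (1::real)"
  shows "2 powr (- t) \<le> 1 - t / 2"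
proof -
  have "exp ((1 - t) *\<^sub>R 0 + t *\<^sub>R (- ln 2)) \<le> (1 - t) * exp 0 + t * exp (- ln 2 :: real)"
    by (rule convex_onD[OF exp_convex]) (use assms in auto)
  then show ?thesis by (simp add: powr_def exp_minus)
qed

text \<open>This is p * (1 - t / 2), where t in [0, 1) is the fractional part of
  \<open>log 2 p\<close>. For p > 0 it equals p exactly at powers of 2.\<close>

definition end_weight :: "real \<Rightarrow> real" where
  "end_weight p = p * (2 + of_int \<lfloor>log 2 p\<rfloor> - log 2 p) / 2"

text \<open>Here t, the difference of \<open>log 2 p\<close> and its ceiling minus 1, lies in (0,
  1], so the value stays strictly below a positive p even at powers of 2.\<close>

definition mid_weight :: "real \<Rightarrow> real" where
  "mid_weight p = p * (1 + of_int \<lceil>log 2 p\<rceil> - log 2 p) / 2"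

definition end_len :: "real \<Rightarrow> nat" where
  "end_len p = nat \<lceil>- log 2 p\<rceil>"

text \<open>For 0 < p <= 1 the slot is at most half as wide as the weight, so the dyadic interval
  around the centre of a segment of that weight stays inside the segment.\<close>

definition mid_len :: "real \<Rightarrow> nat" where
  "mid_len p = nat (\<lfloor>- log 2 p\<rfloor> + 2)"

lemma powr_le_weight:
  assumes "0 < p" "0 \<le> t" "t \<le> 1" "e = log 2 p - t"
  shows "2 powr e \<le> p * (2 - t) / 2"
proof -
  have "2 powr e = p * 2 powr (- t)"
    using assms by (simp add: powr_diff powr_minus divide_inverse)
  also have "\<dots> \<le> p * (1 - t / 2)"
    using powr_le_chord[OF assms(2,3)] assms(1) by (intro mult_left_mono) auto
  finally show ?thesis by (simp add: algebra_simps)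
qed

lemma real_end_len: "0 < p \<Longrightarrow> p \<le> 1 \<Longrightarrow> real (end_len p) = of_int \<lceil>- log 2 p\<rceil>"
  unfolding end_len_def by (subst of_nat_nat) auto

lemma half_power_end_len:
  assumes "0 < p" "p \<le> 1"
  shows "1 / 2 ^ end_len p = (2::real) powr of_int \<lfloor>log 2 p\<rfloor>"
proof -
  have "2 powr of_int \<lfloor>log 2 p\<rfloor> = 2 powr (- real (end_len p))"
    using real_end_len[OF assms] by (simp add: ceiling_minus)
  then show ?thesis by (simp add: powr_minus powr_realpow divide_inverse)
qed

text \<open>The third bound puts 1 - p / 2 into the last dyadic interval of depth
  \<open>end_len p\<close>, without a power of 2 being computed.\<close>

lemma end_weight_bounds:
  assumes "0 < p" "p \<le> 1"
  shows "1 / 2 ^ end_len p \<le> end_weight p" "end_weight p \<le> p" "p / 2 < 1 / 2 ^ end_len p"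
proof -
  have "2 powr of_int \<lfloor>log 2 p\<rfloor> \<le> p * (2 - (log 2 p - of_int \<lfloor>log 2 p\<rfloor>)) / 2"
    using assms by (intro powr_le_weight) (auto, linarith)
  then show "1 / 2 ^ end_len p \<le> end_weight p"
    unfolding half_power_end_len[OF assms] end_weight_def by (simp add: algebra_simps)
  have "of_int \<lfloor>log 2 p\<rfloor> \<le> log 2 p" by simp
  then have "p * (2 + of_int \<lfloor>log 2 p\<rfloor> - log 2 p) \<le> p * 2"
    using assms by (intro mult_left_mono) auto
  then show "end_weight p \<le> p" unfolding end_weight_def by simp
  have "p / 2 = 2 powr (log 2 p - 1)" using assms by (simp add: powr_diff)
  also have "\<dots> < 2 powr of_int \<lfloor>log 2 p\<rfloor>" by (intro powr_less_mono) (linarith, simp)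
  finally show "p / 2 < 1 / 2 ^ end_len p" unfolding half_power_end_len[OF assms] .
qed

text \<open>Equality forces \<open>log 2 p\<close> to be an integer, negative for p < 1, hence at
  most -1.\<close>

lemma end_weight_eq:
  assumes "0 < p" "p < 1" "end_weight p = p"
  shows "p \<le> 1 / 2"
proof -
  have "p * (2 + of_int \<lfloor>log 2 p\<rfloor> - log 2 p) = p * 2"
    using assms(3) unfolding end_weight_def by simp
  then have "2 + of_int \<lfloor>log 2 p\<rfloor> - log 2 p = 2" using assms(1) by (metis mult_left_cancel less_irrefl)
  then have "log 2 p = of_int \<lfloor>log 2 p\<rfloor>" by linarith
  moreover have "log 2 p < 0" using assms(1,2) by simp
  ultimately have "\<lfloor>log 2 p\<rfloor> < 0" by simp
  then have "real_of_int \<lfloor>log 2 p\<rfloor> \<le> -1" by linarith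
  then have "log 2 p \<le> -1" using \<open>log 2 p = of_int \<lfloor>log 2 p\<rfloor>\<close> by linarith
  then have "2 powr log 2 p \<le> 2 powr (-1)" by (intro powr_mono) auto
  then show ?thesis using assms(1) by (simp add: powr_minus)
qed

lemma mid_weight_bounds:
  assumes "0 < p" "p \<le> 1"
  shows "2 / 2 ^ mid_len p \<le> mid_weight p" "mid_weight p < p" "mid_len p \<le> 2 - log 2 p"
proof -
  have len: "real (mid_len p) = of_int \<lfloor>- log 2 p\<rfloor> + 2"
    using assms log_le_zero_cancel_iff[of 2 p] unfolding mid_len_def by (subst of_nat_nat) auto
  then show "mid_len p \<le> 2 - log 2 p" by linarith
  have t: "0 \<le> log 2 p - (of_int \<lceil>log 2 p\<rceil> - 1)" "log 2 p - (of_int \<lceil>log 2 p\<rceil> - 1) \<le> 1"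
    by linarith+
  have "2 powr (of_int \<lceil>log 2 p\<rceil> - 1) \<le> p * (2 - (log 2 p - (of_int \<lceil>log 2 p\<rceil> - 1))) / 2"
    by (rule powr_le_weight[OF assms(1) t]) simp
  moreover have "2 powr (of_int \<lceil>log 2 p\<rceil> - 1) = 2 powr (1 - real (mid_len p))"
    unfolding len by (simp add: floor_minus)
  moreover have "\<dots> = 2 / 2 ^ mid_len p" by (simp add: powr_diff powr_realpow)
  ultimately show "2 / 2 ^ mid_len p \<le> mid_weight p"
    unfolding mid_weight_def by (simp add: algebra_simps)
  have "of_int \<lceil>log 2 p\<rceil> < log 2 p + 1" by linarith
  then have "p * (1 + of_int \<lceil>log 2 p\<rceil> - log 2 p) < p * 2"
    using assms by (intro mult_strict_left_mono) auto
  then show "mid_weight p < p" unfolding mid_weight_def by simp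
qed

section \<open>Slots and points of a given distribution\<close>

definition base_weight :: "nat \<Rightarrow> (nat \<Rightarrow> real) \<Rightarrow> nat \<Rightarrow> real" where
  "base_weight m \<phi> i = (if 1 < i \<and> i < m then mid_weight (\<phi> i) else end_weight (\<phi> i))"

definition slack :: "nat \<Rightarrow> (nat \<Rightarrow> real) \<Rightarrow> real" where
  "slack m \<phi> = (1 - (\<Sum>i=1..m. base_weight m \<phi> i)) / (m + 1)"

definition weight :: "nat \<Rightarrow> (nat \<Rightarrow> real) \<Rightarrow> nat \<Rightarrow> real" where
  "weight m \<phi> i = base_weight m \<phi> i + slack m \<phi>"

text \<open>A middle point is the centre of its segment. The end points lie in the first and the
  last dyadic interval of their depth; these are aligned with the ends of [0, 1), so there a weight
  of one slot width suffices.\<close>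

definition point :: "nat \<Rightarrow> (nat \<Rightarrow> real) \<Rightarrow> nat \<Rightarrow> real" where
  "point m \<phi> i = (if i = 1 then 0 else if i = m then 1 - \<phi> m / 2
     else (\<Sum>j=1..<i. weight m \<phi> j) + weight m \<phi> i / 2)"

text \<open>Two end probabilities of 1/2 are excluded because their base weights already sum to
  1.\<close>

locale code_input =
  fixes m :: nat and \<phi> :: "nat \<Rightarrow> real"
  assumes m: "2 \<le> m" and dist: "prob_dist m \<phi>" and pos: "0 < \<phi> 1" "0 < \<phi> m"
    and not_halves: "\<not> (\<phi> 1 = 1 / 2 \<and> \<phi> m = 1 / 2)"
begin

lemma phi_nonneg: "i \<in> {1..m} \<Longrightarrow> 0 \<le> \<phi> i"
  and phi_sum: "(\<Sum>i=1..m. \<phi> i) = 1"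
  using dist by (auto simp: prob_dist_def)

lemma phi_le_1: "i \<in> {1..m} \<Longrightarrow> \<phi> i \<le> 1"
  using member_le_sum[of i "{1..m}" \<phi>] phi_nonneg phi_sum by simp

lemma base_weight_le: "i \<in> {1..m} \<Longrightarrow> base_weight m \<phi> i \<le> \<phi> i"
proof -
  assume i: "i \<in> {1..m}"
  show ?thesis
  proof (cases "\<phi> i = 0")
    case True
    then show ?thesis by (simp add: base_weight_def mid_weight_def end_weight_def)
  next
    case False
    then have "0 < \<phi> i" using phi_nonneg[OF i] by simp
    then show ?thesis
      using mid_weight_bounds(2)[of "\<phi> i"] end_weight_bounds(2)[of "\<phi> i"] phi_le_1[OF i]
      by (simp add: base_weight_def)
  qed
qed

lemma base_weight_nonneg: "i \<in> {1..m} \<Longrightarrow> 0 \<le> base_weight m \<phi> i"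
proof -
  assume i: "i \<in> {1..m}"
  show ?thesis
  proof (cases "\<phi> i = 0")
    case True
    then show ?thesis by (simp add: base_weight_def mid_weight_def end_weight_def)
  next
    case False
    then have "0 < \<phi> i" using phi_nonneg[OF i] by simp
    then have "1 / 2 ^ end_len (\<phi> i) \<le> end_weight (\<phi> i)" "2 / 2 ^ mid_len (\<phi> i) \<le> mid_weight (\<phi> i)"
      using mid_weight_bounds(1)[of "\<phi> i"] end_weight_bounds(1)[of "\<phi> i"] phi_le_1[OF i] by auto
    from this[THEN order_trans[rotated], of 0] show ?thesis unfolding base_weight_def by simp
  qed
qed

text \<open>The sum of the weights is 1 only if \<open>\<phi> 1\<close> and \<open>\<phi> m\<close> are powers of 2 and the
  other probabilities are 0.\<close>

lemma slack_pos: "0 < slack m \<phi>"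
proof -
  have "(\<Sum>i=1..m. base_weight m \<phi> i) \<noteq> 1"
  proof
    assume "(\<Sum>i=1..m. base_weight m \<phi> i) = 1"
    then have "(\<Sum>i=1..m. \<phi> i - base_weight m \<phi> i) = 0" using phi_sum by (simp add: sum_subtractf)
    then have eq: "base_weight m \<phi> i = \<phi> i" if "i \<in> {1..m}" for i
      using that base_weight_le by (subst (asm) sum_nonneg_eq_0_iff) auto
    have mid: "\<phi> i = 0" if "i \<in> {1<..<m}" for i
    proof (rule ccontr)
      have i: "i \<in> {1..m}" using that by simp
      assume "\<phi> i \<noteq> 0"
      then have "mid_weight (\<phi> i) < \<phi> i"
        using phi_nonneg[OF i] phi_le_1[OF i] by (intro mid_weight_bounds) auto
      then show False using eq[OF i] that by (simp add: base_weight_def)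
    qed
    have "(\<Sum>i=1..m. \<phi> i) = (\<Sum>i\<in>{1, m}. \<phi> i)"
      using m mid by (intro sum.mono_neutral_right) (auto simp: le_eq_less_or_eq)
    then have s: "\<phi> 1 + \<phi> m = 1" using m phi_sum by simp
    have "end_weight (\<phi> 1) = \<phi> 1" "end_weight (\<phi> m) = \<phi> m"
      using eq[of 1] eq[of m] m by (auto simp: base_weight_def)
    \<comment> \<open>Both end probabilities are below 1, since they are positive with sum
      1.\<close>
    then have "\<phi> 1 \<le> 1 / 2" "\<phi> m \<le> 1 / 2" using end_weight_eq s pos by auto
    then show False using s not_halves by linarith
  qed
  moreover have "(\<Sum>i=1..m. base_weight m \<phi> i) \<le> 1"
    using sum_mono[of "{1..m}" "base_weight m \<phi>" \<phi>] base_weight_le phi_sum by simp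
  ultimately show ?thesis unfolding slack_def by simp
qed

lemma weight_pos: "i \<in> {1..m} \<Longrightarrow> 0 < weight m \<phi> i"
  using base_weight_nonneg slack_pos unfolding weight_def by (simp add: add_nonneg_pos)

lemma weight_sum: "(\<Sum>i=1..m. weight m \<phi> i) < 1"
proof -
  have "(\<Sum>i=1..m. weight m \<phi> i) = (\<Sum>i=1..m. base_weight m \<phi> i) + m * slack m \<phi>"
    by (simp add: weight_def sum.distrib)
  also have "\<dots> = 1 - slack m \<phi>" unfolding slack_def by (simp add: field_simps)
  finally show ?thesis using slack_pos by simp
qed

text \<open>Used in the analysis only: the program never computes it, and at probability 0 a length
  of any size costs nothing.\<close>

definition null_len :: nat where
  "null_len = (SOME n. 2 / 2 ^ n \<le> slack m \<phi>)"

lemma null_len: "2 / 2 ^ null_len \<le> slack m \<phi>"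
  unfolding null_len_def
proof (rule someI_ex)
  obtain n where "2 / slack m \<phi> < 2 ^ n" using real_arch_pow[of 2 "2 / slack m \<phi>"] by auto
  then show "\<exists>n. 2 / 2 ^ n \<le> slack m \<phi>" using slack_pos by (auto simp: field_simps intro!: exI[of _ n])
qed

definition slot_len :: "nat \<Rightarrow> nat" where
  "slot_len i = (if i = 1 \<or> i = m then end_len (\<phi> i)
     else if \<phi> i = 0 then null_len else mid_len (\<phi> i))"

lemma slot_len_end: "1 / 2 ^ slot_len i \<le> weight m \<phi> i" if "i = 1 \<or> i = m"
  using that end_weight_bounds(1)[of "\<phi> i"] pos phi_le_1[of i] m slack_pos
  by (auto simp: slot_len_def weight_def base_weight_def)

lemma slot_len_mid: "2 / 2 ^ slot_len i \<le> weight m \<phi> i" if "i \<in> {1<..<m}"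
proof (cases "\<phi> i = 0")
  case True
  then show ?thesis using that null_len by (auto simp: slot_len_def weight_def base_weight_def mid_weight_def)
next
  case False
  then show ?thesis
    using that mid_weight_bounds(1)[of "\<phi> i"] phi_nonneg[of i] phi_le_1[of i] slack_pos
    by (auto simp: slot_len_def weight_def base_weight_def)
qed

text \<open>Each slot but the last lies in the segment between consecutive partial sums of the
  weights, and the last one ends at 1. A strict bound here and a weak one in
  \<open>slot_end_point\<close> make the gaps strict.\<close>

lemma slot_start_point: "(\<Sum>j=1..<i. weight m \<phi> j) < slot_start (point m \<phi> i) (slot_len i)"
  if "i \<in> {1<..m}"
proof (cases "i = m")
  case True
  let ?N = "2 ^ end_len (\<phi> m) :: real"
  have pm: "\<phi> m \<le> 1" using phi_le_1[of m] m by simp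
  have "1 - \<phi> m / 2 < 1" using pos by simp
  moreover have ge: "?N - 1 \<le> (1 - \<phi> m / 2) * ?N"
    using end_weight_bounds(3)[OF pos(2) pm] by (simp add: field_simps)
  ultimately have "\<lfloor>(1 - \<phi> m / 2) * ?N\<rfloor> = 2 ^ end_len (\<phi> m) - 1"
    using pos by (intro floor_unique) auto
  then have "slot_start (point m \<phi> m) (slot_len m) = 1 - 1 / 2 ^ slot_len m"
    using m by (simp add: slot_start_def point_def slot_len_def diff_divide_distrib)
  moreover have "(\<Sum>j=1..<m. weight m \<phi> j) + weight m \<phi> m < 1"
    using weight_sum m by (simp add: sum.last_plus add.commute)
  ultimately show ?thesis using slot_len_end[of m] True by simp
next
  case False
  then have "2 / 2 ^ slot_len i \<le> weight m \<phi> i" using that by (intro slot_len_mid) auto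
  moreover have "point m \<phi> i = (\<Sum>j=1..<i. weight m \<phi> j) + weight m \<phi> i / 2"
    using that False by (simp add: point_def)
  moreover have "point m \<phi> i < slot_start (point m \<phi> i) (slot_len i) + 1 / 2 ^ slot_len i"
    using less_slot_end[of "point m \<phi> i" "slot_len i"]
    by (simp add: slot_start_def slot_end_def add_divide_distrib)
  ultimately show ?thesis by simp
qed

lemma slot_end_point: "slot_end (point m \<phi> i) (slot_len i) \<le> (\<Sum>j=1..<Suc i. weight m \<phi> j)"
  if "i \<in> {1..<m}"
proof (cases "i = 1")
  case True
  then show ?thesis using slot_len_end[of 1] by (simp add: point_def slot_end_def)
next
  case False
  then have "2 / 2 ^ slot_len i \<le> weight m \<phi> i" using that by (intro slot_len_mid) auto
  moreover have "point m \<phi> i = (\<Sum>j=1..<i. weight m \<phi> j) + weight m \<phi> i / 2"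
    using that False by (simp add: point_def)
  moreover have "slot_end (point m \<phi> i) (slot_len i) \<le> point m \<phi> i + 1 / 2 ^ slot_len i"
    using slot_start_le[of "point m \<phi> i" "slot_len i"]
    by (simp add: slot_start_def slot_end_def add_divide_distrib)
  ultimately show ?thesis using that by simp
qed

lemma point_gap: "slot_end (point m \<phi> i) (slot_len i) < slot_start (point m \<phi> (Suc i)) (slot_len (Suc i))"
  if "i \<in> {1..<m}"
  using slot_end_point[OF that] slot_start_point[of "Suc i"] that by simp

definition gap_key :: "nat \<Rightarrow> int" where
  "gap_key i = split_key (point m \<phi> i) (point m \<phi> (Suc i))"

lemma point_less: "point m \<phi> i < point m \<phi> (Suc i)" if "i \<in> {1..<m}"
  using point_gap[OF that] less_slot_end[of "point m \<phi> i" "slot_len i"]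
    slot_start_le[of "point m \<phi> (Suc i)" "slot_len (Suc i)"] by linarith

lemma point_bounds: "0 \<le> point m \<phi> i \<and> point m \<phi> i < 1" if "i \<in> {1..m}"
proof
  have "0 \<le> (\<Sum>j=1..<i. weight m \<phi> j)" "0 < weight m \<phi> i"
    using weight_pos that by (auto simp: less_imp_le intro!: sum_nonneg)
  moreover have "\<phi> m \<le> 1" using phi_le_1[of m] m by simp
  ultimately show "0 \<le> point m \<phi> i" by (simp add: point_def)
  have "i \<le> m" "1 \<le> i" using that by auto
  \<comment> \<open>Downwards from \<open>m\<close>: the last point is below 1 and the points
    increase.\<close>
  then show "point m \<phi> i < 1"
  proof (induction i rule: inc_induct)
    case base
    then show ?case using m pos by (simp add: point_def)
  next
    case (step i)
    then show ?case using point_less[of i] by simp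
  qed
qed

sublocale separated_points m "point m \<phi>" \<phi> slot_len gap_key
proof
  fix i assume i: "i \<in> {1..<m}"
  show "gap_key i = - int (first_diff (point m \<phi> i) (point m \<phi> (Suc i)))"
    unfolding gap_key_def using i point_less[OF i] point_bounds[of i] point_bounds[of "Suc i"]
    by (intro split_key_eq) auto
qed (use point_gap phi_nonneg in auto)

lemma slot_len_cost:
  "(\<Sum>i=1..m. \<phi> i * slot_len i) \<le> entropy m \<phi> + 2
     - \<phi> 1 * (2 - log 2 (\<phi> 1) - of_int \<lceil>- log 2 (\<phi> 1)\<rceil>)
     - \<phi> m * (2 - log 2 (\<phi> m) - of_int \<lceil>- log 2 (\<phi> m)\<rceil>)"
proof -
  let ?c = "\<lambda>i. \<phi> i * (2 - log 2 (\<phi> i) - of_int \<lceil>- log 2 (\<phi> i)\<rceil>)"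
  let ?b = "\<lambda>i. \<phi> i * (2 - log 2 (\<phi> i))"
  \<comment> \<open>At the ends the correction turns the bound into the exact value; since 1 and
    \<open>m\<close> are distinct, at most one correction applies to a symbol.\<close>
  have "\<phi> i * slot_len i \<le> ?b i - (if i = 1 then ?c 1 else 0) - (if i = m then ?c m else 0)"
    if i: "i \<in> {1..m}" for i
  proof (cases "i = 1 \<or> i = m")
    case True
    then have "0 < \<phi> i" using pos by auto
    then have "\<phi> i * slot_len i = \<phi> i * of_int \<lceil>- log 2 (\<phi> i)\<rceil>"
      using True real_end_len[of "\<phi> i"] phi_le_1[OF i] by (auto simp: slot_len_def)
    then show ?thesis using True m by (auto simp: algebra_simps)
  next
    case False
    have "\<phi> i * slot_len i \<le> ?b i"
    proof (cases "\<phi> i = 0")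
      case nz: False
      then have "real (mid_len (\<phi> i)) \<le> 2 - log 2 (\<phi> i)"
        using phi_nonneg[OF i] phi_le_1[OF i] by (intro mid_weight_bounds) auto
      then show ?thesis using False nz phi_nonneg[OF i] by (auto simp: slot_len_def intro: mult_left_mono)
    qed simp
    then show ?thesis using False by simp
  qed
  then have "(\<Sum>i=1..m. \<phi> i * slot_len i)
      \<le> (\<Sum>i=1..m. ?b i - (if i = 1 then ?c 1 else 0) - (if i = m then ?c m else 0))"
    by (rule sum_mono)
  also have "\<dots> = (\<Sum>i=1..m. ?b i) - ?c 1 - ?c m"
    using m by (simp add: sum_subtractf)
  also have "(\<Sum>i=1..m. ?b i) = entropy m \<phi> + 2"
    using phi_sum by (simp add: entropy_def right_diff_distrib sum_subtractf flip: sum_distrib_right)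
  finally show ?thesis .
qed

theorem avg_length_gap_tree:
  assumes "cartesian gap_key T 1 m"
  shows "avg_length m \<phi> (codeword T) \<le> entropy m \<phi> + 2
     - \<phi> 1 * (2 - log 2 (\<phi> 1) - of_int \<lceil>- log 2 (\<phi> 1)\<rceil>)
     - \<phi> m * (2 - log 2 (\<phi> m) - of_int \<lceil>- log 2 (\<phi> m)\<rceil>)
     - (\<Sum>i=1..m-1. min (\<phi> i) (\<phi> (i + 1)))"
  using avg_length_cartesian[OF assms point_bounds] slot_len_cost by linarith

end

section \<open>Running programs\<close>

text \<open>Loop-free commands act as functions with a cost bound independent of the state, which
  reduces the cost analysis to counting iterations.\<close>

fun loop_free :: "com \<Rightarrow> bool" where
  "loop_free (Seq c1 c2) \<longleftrightarrow> loop_free c1 \<and> loop_free c2"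
| "loop_free (If b c1 c2) \<longleftrightarrow> loop_free c1 \<and> loop_free c2"
| "loop_free (While b c) \<longleftrightarrow> False"
| "loop_free c \<longleftrightarrow> True"

fun run :: "com \<Rightarrow> state \<Rightarrow> state" where
  "run (Write x e a) s = s(x := (s x)(addr (aval e s) := aval a s))"
| "run (Seq c1 c2) s = run c2 (run c1 s)"
| "run (If b c1 c2) s = (if bval b s then run c1 s else run c2 s)"
| "run c s = s"

fun max_cost :: "com \<Rightarrow> nat" where
  "max_cost (Write x e a) = 1 + acost e + acost a"
| "max_cost (Seq c1 c2) = max_cost c1 + max_cost c2"
| "max_cost (If b c1 c2) = 1 + bcost b + max_cost c1 + max_cost c2"
| "max_cost c = 1"

lemma exec_run:
  assumes "loop_free c"
  shows "\<exists>t \<le> max_cost c. exec c s t (run c s)"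
  using assms
proof (induction c arbitrary: s)
  case (Write x e a)
  show ?case unfolding run.simps max_cost.simps by (blast intro: exec.Write)
next
  case (Seq c1 c2)
  then obtain t1 t2 where "t1 \<le> max_cost c1" "exec c1 s t1 (run c1 s)"
    "t2 \<le> max_cost c2" "exec c2 (run c1 s) t2 (run c2 (run c1 s))" by (metis loop_free.simps(1))
  then show ?case using exec.Seq by (auto intro!: exI[of _ "t1 + t2"])
next
  case (If b c1 c2)
  then obtain t1 t2 where t: "t1 \<le> max_cost c1" "exec c1 s t1 (run c1 s)"
    "t2 \<le> max_cost c2" "exec c2 s t2 (run c2 s)" by (metis loop_free.simps(2))
  show ?case
  proof (cases "bval b s")
    case True
    from exec.IfTrue[OF this t(2)] t(1) show ?thesis
      using True by (intro exI[of _ "1 + bcost b + t1"]) simp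
  next
    case False
    from exec.IfFalse[OF this t(4)] t(3) show ?thesis
      using False by (intro exI[of _ "1 + bcost b + t2"]) simp
  qed
next
  case Skip
  show ?case unfolding run.simps max_cost.simps by (blast intro: exec.Skip)
qed simp

text \<open>The index of the invariant is a variant, so it bounds the number of iterations; the
  extra 1 pays for the final test.\<close>

lemma exec_while:
  assumes lf: "loop_free c"
    and step: "\<And>n s. I n s \<Longrightarrow> bval b s \<Longrightarrow> \<exists>n'<n. I n' (run c s)"
    and init: "I n s"
  shows "\<exists>t s' n'. exec (While b c) s t s' \<and> I n' s' \<and> \<not> bval b s' \<and>
           t \<le> (n + 1) * (1 + bcost b + max_cost c)"
  using init
proof (induction n arbitrary: s rule: less_induct)
  case (less n)
  show ?case
  proof (cases "bval b s")
    case True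
    obtain n' where n': "n' < n" "I n' (run c s)" using step[OF less.prems True] by auto
    obtain t1 where t1: "t1 \<le> max_cost c" "exec c s t1 (run c s)" using exec_run[OF lf] by auto
    obtain t s' n'' where t: "exec (While b c) (run c s) t s'" "I n'' s'" "\<not> bval b s'"
      "t \<le> (n' + 1) * (1 + bcost b + max_cost c)" using less.IH[OF n'] by auto
    have "1 + bcost b + t1 + t \<le> (1 + bcost b + max_cost c) + n * (1 + bcost b + max_cost c)"
      using t1(1) t(4) n'(1) mult_le_mono1[of "n' + 1" n "1 + bcost b + max_cost c"] by linarith
    then show ?thesis using exec.WhileTrue[OF True t1(2) t(1)] t(2,3) by fastforce
  next
    case False
    have "1 + bcost b \<le> (n + 1) * (1 + bcost b + max_cost c)" by simp
    then show ?thesis using exec.WhileFalse[OF False] less.prems False by blast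
  qed
qed

lemma addr_of_nat [simp]: "addr (real n) = n"
  by (simp add: addr_def)

lemma addr_simps [simp]: "addr 0 = 0" "addr 1 = 1" "addr (numeral k) = numeral k"
  by (simp_all add: addr_def)

lemma addr_add [simp]: "addr (real a + real b) = a + b" "addr (real a + 1) = Suc a" "addr (1 + real a) = Suc a"
  using addr_of_nat[of "a + b"] addr_of_nat[of "Suc a"] by (simp_all add: add.commute del: addr_of_nat)

section \<open>The program\<close>

abbreviation var :: "string \<Rightarrow> aexp" where "var x \<equiv> Read x (Num 0)"
abbreviation set_var :: "string \<Rightarrow> aexp \<Rightarrow> com" where "set_var x e \<equiv> Write x (Num 0) e"

definition end_weight_exp :: "aexp \<Rightarrow> aexp" where
  "end_weight_exp p = Div (Mul p (Sub (Add (Num 2) (Floor (Log2 p))) (Log2 p))) (Num 2)"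

definition mid_weight_exp :: "aexp \<Rightarrow> aexp" where
  "mid_weight_exp p = Div (Mul p (Sub (Add (Num 1) (Ceil (Log2 p))) (Log2 p))) (Num 2)"

definition split_key_exp :: "aexp \<Rightarrow> aexp \<Rightarrow> aexp" where
  "split_key_exp a b = Floor (Log2 (Div (Add (Xor a b) (Sub b a)) (Num 2)))"

lemma aval_weight_exp [simp]:
  "aval (end_weight_exp p) s = end_weight (aval p s)"
  "aval (mid_weight_exp p) s = mid_weight (aval p s)"
  "aval (split_key_exp a b) s = of_int (split_key (aval a s) (aval b s))"
  by (simp_all add: end_weight_exp_def mid_weight_exp_def split_key_exp_def
      end_weight_def mid_weight_def split_key_def)

definition weights_body :: com where
  "weights_body =
     Seq (If (And (Less (Num 1) (var ''i'')) (Less (var ''i'') (var ''m'')))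
           (Write ''weight'' (var ''i'') (mid_weight_exp (Read ''phi'' (var ''i''))))
           (Write ''weight'' (var ''i'') (end_weight_exp (Read ''phi'' (var ''i'')))))
     (Seq (set_var ''total'' (Add (var ''total'') (Read ''weight'' (var ''i''))))
       (set_var ''i'' (Add (var ''i'') (Num 1))))"

definition points_body :: com where
  "points_body =
     Seq (set_var ''w'' (Add (Read ''weight'' (var ''i'')) (var ''slack'')))
    (Seq (Write ''point'' (var ''i'') (Add (var ''sum'') (Div (var ''w'') (Num 2))))
    (Seq (set_var ''sum'' (Add (var ''sum'') (var ''w'')))
       (set_var ''i'' (Add (var ''i'') (Num 1)))))"

definition key_exp :: "aexp \<Rightarrow> aexp" where
  "key_exp g = split_key_exp (Read ''point'' g) (Read ''point'' (Add g (Num 1)))"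

definition tree_guard :: bexp where
  "tree_guard = Not (And (Equal (var ''i'') (var ''m'')) (Equal (var ''top'') (Num 0)))"

text \<open>The second conjunct is the implication from i < m to a smaller key at the top. At i = m
  no gap is left, and the remaining nodes are all popped.\<close>

definition pop_guard :: bexp where
  "pop_guard = And (Less (Num 0) (var ''top''))
     (Not (And (Less (var ''i'') (var ''m''))
       (Not (Less (key_exp (Read ''stack'' (var ''top''))) (key_exp (var ''i''))))))"

text \<open>\<open>cur\<close> is the finished subtree that ends at leaf \<open>i\<close>. It
  becomes the right child of the top node, and that node becomes current.\<close>

definition pop_com :: com where
  "pop_com =
     Seq (Write ''right'' (Add (var ''m'') (Read ''stack'' (var ''top''))) (var ''cur''))
    (Seq (set_var ''cur'' (Add (var ''m'') (Read ''stack'' (var ''top''))))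
       (set_var ''top'' (Sub (var ''top'') (Num 1))))"

text \<open>The current subtree becomes the left child of the node for gap \<open>i\<close>, whose
  right subtree starts afresh with the next leaf.\<close>

definition push_com :: com where
  "push_com =
     Seq (Write ''left'' (Add (var ''m'') (var ''i'')) (var ''cur''))
    (Seq (set_var ''top'' (Add (var ''top'') (Num 1)))
    (Seq (Write ''stack'' (var ''top'') (var ''i''))
    (Seq (set_var ''i'' (Add (var ''i'') (Num 1)))
       (set_var ''cur'' (var ''i'')))))"

definition loop_guard :: bexp where
  "loop_guard = Not (Less (var ''m'') (var ''i''))"

text \<open>The second loop treats all points as centres; afterwards the two end points are
  overwritten.\<close>

definition code_program :: com where
  "code_program =
     Seq (set_var ''i'' (Num 1))
    (Seq (While loop_guard weights_body)
    (Seq (Seq (set_var ''slack'' (Div (Sub (Num 1) (var ''total'')) (Add (var ''m'') (Num 1))))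
       (set_var ''i'' (Num 1)))
    (Seq (While loop_guard points_body)
    (Seq (Seq (Write ''point'' (Num 1) (Num 0))
         (Seq (Write ''point'' (var ''m'') (Sub (Num 1) (Div (Read ''phi'' (var ''m'')) (Num 2))))
         (Seq (set_var ''i'' (Num 1)) (set_var ''cur'' (Num 1)))))
    (Seq (While tree_guard (If pop_guard pop_com push_com))
       (set_var ''root'' (var ''cur'')))))))"

lemma run_weights_body:
  assumes "s ''i'' 0 = real i" "s ''m'' 0 = real m"
  shows "run weights_body s = s(''weight'' := (s ''weight'')(i := base_weight m (s ''phi'') i),
    ''total'' := (s ''total'')(0 := s ''total'' 0 + base_weight m (s ''phi'') i),
    ''i'' := (s ''i'')(0 := real i + 1))"
  using assms by (simp add: weights_body_def base_weight_def)

lemma run_points_body: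
  assumes "s ''i'' 0 = real i"
  shows "run points_body s = s(''w'' := (s ''w'')(0 := s ''weight'' i + s ''slack'' 0),
    ''point'' := (s ''point'')(i := s ''sum'' 0 + (s ''weight'' i + s ''slack'' 0) / 2),
    ''sum'' := (s ''sum'')(0 := s ''sum'' 0 + (s ''weight'' i + s ''slack'' 0)),
    ''i'' := (s ''i'')(0 := real i + 1))"
  using assms by (simp add: points_body_def)

lemma run_pop_com:
  assumes "s ''m'' 0 = real m" "s ''top'' 0 = real (Suc k)" "s ''stack'' (Suc k) = real j"
  shows "run pop_com s = s(''right'' := (s ''right'')(m + j := s ''cur'' 0),
    ''cur'' := (s ''cur'')(0 := real (m + j)), ''top'' := (s ''top'')(0 := real k))"
  using assms by (simp add: pop_com_def)

lemma run_push_com: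
  assumes "s ''m'' 0 = real m" "s ''top'' 0 = real k" "s ''i'' 0 = real i"
  shows "run push_com s = s(''left'' := (s ''left'')(m + i := s ''cur'' 0),
    ''top'' := (s ''top'')(0 := real k + 1), ''stack'' := (s ''stack'')(Suc k := real i),
    ''i'' := (s ''i'')(0 := real i + 1), ''cur'' := (s ''cur'')(0 := real i + 1))"
  using assms by (simp add: push_com_def)

section \<open>Invariants of the loops for the weights and the points\<close>

lemma weights_loop:
  assumes "s ''m'' 0 = real m" "s ''i'' 0 = 1" "s ''total'' 0 = 0"
  shows "\<exists>t s'. exec (While loop_guard weights_body) s t s' \<and>
    t \<le> (m + 1) * (1 + bcost loop_guard + max_cost weights_body) \<and>
    (\<forall>y\<in>{''m'', ''phi'', ''sum'', ''top''}. s' y = s y) \<and>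
    (\<forall>j\<in>{1..m}. s' ''weight'' j = base_weight m (s ''phi'') j) \<and>
    s' ''total'' 0 = (\<Sum>j=1..m. base_weight m (s ''phi'') j)"
proof -
  \<comment> \<open>\<open>n\<close> counts the remaining symbols \<open>i\<close>, ...,
    \<open>m\<close>; the listed arrays are preserved for later phases.\<close>
  define I where "I n s' \<longleftrightarrow> (\<exists>i. 1 \<le> i \<and> i + n = Suc m \<and> s' ''i'' 0 = real i \<and>
    (\<forall>y\<in>{''m'', ''phi'', ''sum'', ''top''}. s' y = s y) \<and>
    (\<forall>j\<in>{1..<i}. s' ''weight'' j = base_weight m (s ''phi'') j) \<and>
    s' ''total'' 0 = (\<Sum>j=1..<i. base_weight m (s ''phi'') j))" for n and s' :: state
  have "I m s" unfolding I_def using assms by (intro exI[of _ 1]) simp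
  moreover have "\<exists>n'<n. I n' (run weights_body s')" if asm: "I n s'" "bval loop_guard s'" for n s'
  proof -
    obtain i where i: "1 \<le> i" "i + n = Suc m" "s' ''i'' 0 = real i"
      "\<forall>y\<in>{''m'', ''phi'', ''sum'', ''top''}. s' y = s y"
      "\<forall>j\<in>{1..<i}. s' ''weight'' j = base_weight m (s ''phi'') j"
      "s' ''total'' 0 = (\<Sum>j=1..<i. base_weight m (s ''phi'') j)"
      using asm(1) unfolding I_def by (elim exE conjE) (rule that)
    have m: "s' ''m'' 0 = real m" and phi: "s' ''phi'' = s ''phi''" using i(4) assms(1) by simp_all
    have "i \<le> m" using asm(2) i(3) m by (simp add: loop_guard_def)
    then have "I (m - i) (run weights_body s')"
      unfolding I_def using i m phi
      by (intro exI[of _ "Suc i"]) (auto simp: run_weights_body less_Suc_eq add.commute)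
    then show ?thesis using \<open>i \<le> m\<close> i(2) by (intro exI[of _ "m - i"]) simp
  qed
  ultimately obtain t s' n' where t: "exec (While loop_guard weights_body) s t s'" "I n' s'"
    "\<not> bval loop_guard s'" "t \<le> (m + 1) * (1 + bcost loop_guard + max_cost weights_body)"
    using exec_while[of weights_body I loop_guard m s] by (auto simp: weights_body_def)
  obtain i where i: "i + n' = Suc m" "s' ''i'' 0 = real i"
      "\<forall>y\<in>{''m'', ''phi'', ''sum'', ''top''}. s' y = s y"
      "\<forall>j\<in>{1..<i}. s' ''weight'' j = base_weight m (s ''phi'') j"
      "s' ''total'' 0 = (\<Sum>j=1..<i. base_weight m (s ''phi'') j)"
      using t(2) unfolding I_def by (elim exE conjE) (rule that)
  have "i = Suc m" using t(3) i(1-3) assms(1) by (simp add: loop_guard_def)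
  then show ?thesis using t(1,4) i(3-5) by (intro exI[of _ t] exI[of _ s']) (simp add: atLeastLessThanSuc_atLeastAtMost)
qed

lemma points_loop:
  assumes "s ''m'' 0 = real m" "s ''i'' 0 = 1" "s ''sum'' 0 = 0" "s ''slack'' 0 = d"
  shows "\<exists>t s'. exec (While loop_guard points_body) s t s' \<and>
    t \<le> (m + 1) * (1 + bcost loop_guard + max_cost points_body) \<and>
    (\<forall>y\<in>{''m'', ''phi'', ''weight'', ''slack'', ''top''}. s' y = s y) \<and>
    (\<forall>j\<in>{1..m}. s' ''point'' j = (\<Sum>k=1..<j. s ''weight'' k + d) + (s ''weight'' j + d) / 2)"
proof -
  define p where "p j = (\<Sum>k=1..<j. s ''weight'' k + d) + (s ''weight'' j + d) / 2" for j
  define I where "I n s' \<longleftrightarrow> (\<exists>i. 1 \<le> i \<and> i + n = Suc m \<and> s' ''i'' 0 = real i \<and>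
    (\<forall>y\<in>{''m'', ''phi'', ''weight'', ''slack'', ''top''}. s' y = s y) \<and>
    (\<forall>j\<in>{1..<i}. s' ''point'' j = p j) \<and>
    s' ''sum'' 0 = (\<Sum>k=1..<i. s ''weight'' k + d))" for n and s' :: state
  have "I m s" unfolding I_def using assms by (intro exI[of _ 1]) simp
  moreover have "\<exists>n'<n. I n' (run points_body s')" if asm: "I n s'" "bval loop_guard s'" for n s'
  proof -
    obtain i where i: "1 \<le> i" "i + n = Suc m" "s' ''i'' 0 = real i"
      "\<forall>y\<in>{''m'', ''phi'', ''weight'', ''slack'', ''top''}. s' y = s y"
      "\<forall>j\<in>{1..<i}. s' ''point'' j = p j"
      "s' ''sum'' 0 = (\<Sum>k=1..<i. s ''weight'' k + d)"
      using asm(1) unfolding I_def by (elim exE conjE) (rule that)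
    have m: "s' ''m'' 0 = real m" and w: "s' ''weight'' = s ''weight''" "s' ''slack'' 0 = d"
      using i(4) assms by simp_all
    have "i \<le> m" using asm(2) i(3) m by (simp add: loop_guard_def)
    then have "I (m - i) (run points_body s')"
      unfolding I_def using i m w
      by (intro exI[of _ "Suc i"]) (auto simp: run_points_body p_def less_Suc_eq add.commute)
    then show ?thesis using \<open>i \<le> m\<close> i(2) by (intro exI[of _ "m - i"]) simp
  qed
  ultimately obtain t s' n' where t: "exec (While loop_guard points_body) s t s'" "I n' s'"
    "\<not> bval loop_guard s'" "t \<le> (m + 1) * (1 + bcost loop_guard + max_cost points_body)"
    using exec_while[of points_body I loop_guard m s] by (auto simp: points_body_def)
  obtain i where i: "i + n' = Suc m" "s' ''i'' 0 = real i"
      "\<forall>y\<in>{''m'', ''phi'', ''weight'', ''slack'', ''top''}. s' y = s y"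
      "\<forall>j\<in>{1..<i}. s' ''point'' j = p j"
      using t(2) unfolding I_def by (elim exE conjE) (rule that)
  have "i = Suc m" using t(3) i(1-3) assms(1) by (simp add: loop_guard_def)
  then show ?thesis unfolding p_def[symmetric] using t(1,4) i(3-4)
    by (intro exI[of _ t] exI[of _ s']) (simp add: atLeastLessThanSuc_atLeastAtMost)
qed

section \<open>Trees in memory\<close>

fun address :: "nat \<Rightarrow> tree \<Rightarrow> nat" where
  "address m (Leaf i) = i"
| "address m (Node j L R) = m + j"

fun stored :: "nat \<Rightarrow> state \<Rightarrow> tree \<Rightarrow> bool" where
  "stored m s (Leaf i) \<longleftrightarrow> True"
| "stored m s (Node j L R) \<longleftrightarrow>
     s ''left'' (m + j) = real (address m L) \<and> s ''right'' (m + j) = real (address m R) \<and>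
     stored m s L \<and> stored m s R"

text \<open>A tree on the leaves \<open>l\<close> to \<open>r\<close> occupies only the cells of the
  gaps between them, so writes for other gaps preserve it.\<close>

lemma stored_cong:
  assumes "cartesian K T l r"
    and "\<And>g. g \<in> {l..<r} \<Longrightarrow> s' ''left'' (m + g) = s ''left'' (m + g) \<and> s' ''right'' (m + g) = s ''right'' (m + g)"
    and "stored m s T"
  shows "stored m s' T"
  using assms
proof (induction T arbitrary: l r)
  case (Node j L R)
  have j: "l \<le> j" "j < r" using cartesian_Node_bounds[OF Node.prems(1)] by auto
  have "stored m s' L" using Node.IH(1)[of l j] Node.prems j by simp
  moreover have "stored m s' R" using Node.IH(2)[of "Suc j" r] Node.prems j by simp
  ultimately show ?case using Node.prems(2)[of j] Node.prems(3) j by simp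
qed simp

text \<open>Internal addresses exceed \<open>m\<close>, so a path cannot pass through a leaf; the
  leaf ranges of the two subtrees are disjoint, which makes the string unique.\<close>

lemma reaches_iff:
  assumes "cartesian K T l r" "stored m s T" "1 \<le> l" "r \<le> m" "i \<le> m"
  shows "reaches m s (address m T) bs i \<longleftrightarrow> l \<le> i \<and> i \<le> r \<and> bs = codeword T i"
  using assms
proof (induction T arbitrary: l r bs)
  case (Leaf j)
  then show ?case by (cases bs) auto
next
  case (Node j L R)
  have j: "l \<le> j" "j < r" using cartesian_Node_bounds[OF Node.prems(1)] by auto
  show ?case
  proof (cases bs)
    case Nil
    then show ?thesis using j Node.prems by simp
  next
    case (Cons b bs')
    have "reaches m s (address m L) bs' i \<longleftrightarrow> l \<le> i \<and> i \<le> j \<and> bs' = codeword L i"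
      using Node.prems j by (intro Node.IH(1)) auto
    moreover have "reaches m s (address m R) bs' i \<longleftrightarrow> Suc j \<le> i \<and> i \<le> r \<and> bs' = codeword R i"
      using Node.prems j by (intro Node.IH(2)) auto
    ultimately show ?thesis using Cons Node.prems j by (cases b) (auto simp: child_def)
  qed
qed

lemma represents_codeword:
  assumes "cartesian K T 1 m" "stored m s T" "s ''root'' 0 = real (address m T)"
  shows "represents m s (codeword T)"
  unfolding represents_def using reaches_iff[OF assms(1,2)] assms(3) by simp

section \<open>The construction of the tree\<close>

text \<open>An element \<open>(j, L)\<close> of the stack is a node \<open>j\<close> with left subtree \<open>L\<close> whose right
  subtree is still under construction; \<open>l\<close> is the first leaf of the right subtree of the top.\<close>

fun stacked :: "(nat \<Rightarrow> int) \<Rightarrow> (nat \<times> tree) list \<Rightarrow> nat \<Rightarrow> bool" where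
  "stacked K [] l \<longleftrightarrow> l = 1"
| "stacked K ((j, L) # st) l \<longleftrightarrow> l = Suc j \<and> (\<exists>k. cartesian K L k j \<and> (\<forall>g\<in>{k..<j}. K g \<le> K j) \<and>
     stacked K st k \<and> (st \<noteq> [] \<longrightarrow> K j \<le> K (fst (hd st))))"

text \<open>The bottom of the stack is in cell 1 of the array. The right child of a stacked node is
  still unconstrained.\<close>

fun stack_stored :: "nat \<Rightarrow> state \<Rightarrow> (nat \<times> tree) list \<Rightarrow> bool" where
  "stack_stored m s [] \<longleftrightarrow> True"
| "stack_stored m s ((j, L) # st) \<longleftrightarrow>
     s ''stack'' (Suc (length st)) = real j \<and> s ''left'' (m + j) = real (address m L) \<and>
     stored m s L \<and> stack_stored m s st"

lemma stacked_ge_1: "stacked K st l \<Longrightarrow> 1 \<le> l"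
  by (cases st) auto

lemma stack_stored_cong:
  assumes "stacked K st l"
    and "\<And>g. g \<in> {1..<l} \<Longrightarrow> s' ''left'' (m + g) = s ''left'' (m + g) \<and> s' ''right'' (m + g) = s ''right'' (m + g)"
    and "\<And>n. n \<le> length st \<Longrightarrow> s' ''stack'' n = s ''stack'' n"
    and "stack_stored m s st"
  shows "stack_stored m s' st"
  using assms
proof (induction K st l rule: stacked.induct)
  case (2 K j L st l)
  obtain k where l: "l = Suc j" and k: "cartesian K L k j" "stacked K st k" using 2 by auto
  have kj: "1 \<le> k" "k \<le> j" using stacked_ge_1[OF k(2)] cartesian_le[OF k(1)] by auto
  have "stored m s' L"
    using 2(5) kj l by (intro stored_cong[OF k(1), of s' m s] 2(3)) auto
  moreover have "stack_stored m s' st"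
    using 2(4,5) kj l by (intro 2(1)[OF k(2)] 2(3)) auto
  moreover have "s' ''stack'' (Suc (length st)) = s ''stack'' (Suc (length st))" using 2(4) by simp
  ultimately show ?case using 2(3)[of j] 2(5) kj l by simp
qed simp

text \<open>\<open>T\<close> covers the leaves from \<open>l\<close> to \<open>i\<close>; the last
  two conditions allow it to become a left subtree at gap \<open>i\<close> or a right subtree of the
  top. The potential \<open>n\<close> drops by 1 at each step: a push lowers 2 * (m - i) by 2 and
  adds one element, a pop removes one.\<close>

definition building :: "nat \<Rightarrow> (nat \<Rightarrow> int) \<Rightarrow> nat \<Rightarrow> state \<Rightarrow> bool" where
  "building m K n s \<longleftrightarrow> (\<exists>i st T l. 1 \<le> i \<and> i \<le> m \<and> n = 2 * (m - i) + length st \<and>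
     s ''m'' 0 = real m \<and> s ''i'' 0 = real i \<and> s ''top'' 0 = real (length st) \<and>
     s ''cur'' 0 = real (address m T) \<and> stored m s T \<and> stack_stored m s st \<and>
     (\<forall>g\<in>{1..<m}. K g = split_key (s ''point'' g) (s ''point'' (Suc g))) \<and>
     stacked K st l \<and> cartesian K T l i \<and> (i < m \<longrightarrow> (\<forall>g\<in>{l..<i}. K g \<le> K i)) \<and>
     (st \<noteq> [] \<longrightarrow> (\<forall>g\<in>{l..<i}. K g \<le> K (fst (hd st)))))"

lemma building_step:
  assumes "building m K n s" "bval tree_guard s"
  shows "\<exists>n'<n. building m K n' (run (If pop_guard pop_com push_com) s)"
proof -
  obtain i st T l where i: "1 \<le> i" "i \<le> m" and n: "n = 2 * (m - i) + length st"
    and s: "s ''m'' 0 = real m" "s ''i'' 0 = real i" "s ''top'' 0 = real (length st)"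
      "s ''cur'' 0 = real (address m T)"
    and T: "stored m s T" and sts: "stack_stored m s st"
    and K: "\<forall>g\<in>{1..<m}. K g = split_key (s ''point'' g) (s ''point'' (Suc g))"
    and st: "stacked K st l" and ct: "cartesian K T l i"
    and Ki: "i < m \<longrightarrow> (\<forall>g\<in>{l..<i}. K g \<le> K i)"
    and Kt: "st \<noteq> [] \<longrightarrow> (\<forall>g\<in>{l..<i}. K g \<le> K (fst (hd st)))"
    using assms(1) unfolding building_def by (elim exE conjE) (rule that)
  have li: "1 \<le> l" "l \<le> i" using stacked_ge_1[OF st] cartesian_le[OF ct] by auto
  have guard: "bval pop_guard s \<longleftrightarrow> st \<noteq> [] \<and> (i < m \<longrightarrow> K (fst (hd st)) < K i)"
  proof (cases st)
    case Nil
    then show ?thesis by (simp add: pop_guard_def s)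
  next
    case (Cons a st')
    obtain j L where a: "a = (j, L)" by (cases a)
    have j: "l = Suc j" "1 \<le> j"
      using st stacked_ge_1 cartesian_le unfolding Cons a by fastforce+
    have "s ''stack'' (Suc (length st')) = real j" using sts unfolding Cons a by simp
    then show ?thesis
      using K j li i unfolding Cons a by (auto simp: pop_guard_def key_exp_def s Cons)
  qed
  show ?thesis
  proof (cases "bval pop_guard s")
    case True
    then obtain j L st' where eq: "st = (j, L) # st'" using guard by (cases st) auto
    obtain k where l: "l = Suc j" and L: "cartesian K L k j" "\<forall>g\<in>{k..<j}. K g \<le> K j"
      and k: "stacked K st' k" and top: "st' \<noteq> [] \<longrightarrow> K j \<le> K (fst (hd st'))"
      using st unfolding eq by auto
    have kj: "1 \<le> k" "k \<le> j" using stacked_ge_1[OF k] cartesian_le[OF L(1)] by auto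
    let ?s = "run pop_com s"
    have run: "?s = s(''right'' := (s ''right'')(m + j := s ''cur'' 0),
      ''cur'' := (s ''cur'')(0 := real (m + j)), ''top'' := (s ''top'')(0 := real (length st')))"
      using s sts unfolding eq by (intro run_pop_com) auto
    have same: "?s ''left'' (m + g) = s ''left'' (m + g) \<and> ?s ''right'' (m + g) = s ''right'' (m + g)"
      if "g \<noteq> j" for g using that by (simp add: run)
    \<comment> \<open>Gap \<open>j\<close> dominates its left subtree by the stack invariant and its
      right subtree \<open>T\<close> by the condition on the top.\<close>
    have Kj: "\<forall>g\<in>{k..<i}. K g \<le> K j"
    proof
      fix g assume "g \<in> {k..<i}"
      moreover have "\<forall>g\<in>{Suc j..<i}. K g \<le> K j" using Kt unfolding eq l by simp
      ultimately show "K g \<le> K j" using L(2) by (cases g j rule: linorder_cases) auto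
    qed
    have "stored m ?s L" by (rule stored_cong[OF L(1)]) (use sts same in \<open>auto simp: eq\<close>)
    moreover have "stored m ?s T" by (rule stored_cong[OF ct]) (use T same in \<open>auto simp: l\<close>)
    moreover have "?s ''left'' (m + j) = real (address m L)" "?s ''right'' (m + j) = real (address m T)"
      using sts s by (simp_all add: run eq)
    ultimately have "stored m ?s (Node j L T)" by simp
    moreover have "stack_stored m ?s st'"
      by (rule stack_stored_cong[OF k]) (use sts same kj in \<open>auto simp: eq run\<close>)
    moreover have "cartesian K (Node j L T) k i"
      using L(1) ct Kj l by simp
    \<comment> \<open>For i < m the pop occurs only if \<open>K j < K i\<close>.\<close>
    moreover have "i < m \<longrightarrow> (\<forall>g\<in>{k..<i}. K g \<le> K i)"
      using True guard Kj by (auto simp: eq intro: order_trans less_imp_le)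
    moreover have "st' \<noteq> [] \<longrightarrow> (\<forall>g\<in>{k..<i}. K g \<le> K (fst (hd st')))"
      using top Kj by (auto intro: order_trans)
    moreover have "?s ''m'' 0 = real m" "?s ''i'' 0 = real i" "?s ''top'' 0 = real (length st')"
      "?s ''cur'' 0 = real (address m (Node j L T))" "?s ''point'' = s ''point''"
      using s by (simp_all add: run)
    ultimately have "building m K (2 * (m - i) + length st') ?s"
      unfolding building_def using i K k by (intro exI[of _ i] exI[of _ st'] exI[of _ "Node j L T"] exI[of _ k]) simp
    then show ?thesis using True unfolding n eq by (intro exI[of _ "2 * (m - i) + length st'"]) simp
  next
    case False
    \<comment> \<open>Without a pop at i = m the stack is empty, and the loop would have
      stopped.\<close>
    have im: "i < m"
    proof (rule ccontr)
      assume "\<not> i < m"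
      then have "i = m" "st = []" using i(2) False guard by auto
      then show False using assms(2) s by (simp add: tree_guard_def)
    qed
    let ?s = "run push_com s"
    have run: "?s = s(''left'' := (s ''left'')(m + i := s ''cur'' 0),
      ''top'' := (s ''top'')(0 := real (length st) + 1), ''stack'' := (s ''stack'')(Suc (length st) := real i),
      ''i'' := (s ''i'')(0 := real i + 1), ''cur'' := (s ''cur'')(0 := real i + 1))"
      using s by (intro run_push_com) auto
    have same: "?s ''left'' (m + g) = s ''left'' (m + g) \<and> ?s ''right'' (m + g) = s ''right'' (m + g)"
      if "g \<noteq> i" for g using that by (simp add: run)
    have "stored m ?s T" by (rule stored_cong[OF ct]) (use T same in auto)
    moreover have "stack_stored m ?s st"
      by (rule stack_stored_cong[OF st]) (use sts same li in \<open>auto simp: run\<close>)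
    moreover have "?s ''left'' (m + i) = real (address m T)" "?s ''stack'' (Suc (length st)) = real i"
      using s by (simp_all add: run)
    ultimately have "stack_stored m ?s ((i, T) # st)" by simp
    \<comment> \<open>No pop from a nonempty stack means that \<open>K i\<close> is at most the key
      of the top, so the keys stay ordered along the stack.\<close>
    moreover have "stacked K ((i, T) # st) (Suc i)"
      using ct st Ki im False guard by (auto simp: not_less)
    moreover have "?s ''m'' 0 = real m" "?s ''i'' 0 = real (Suc i)" "?s ''top'' 0 = real (length ((i, T) # st))"
      "?s ''cur'' 0 = real (address m (Leaf (Suc i)))" "?s ''point'' = s ''point''"
      using s by (simp_all add: run)
    ultimately have "building m K (2 * (m - Suc i) + length ((i, T) # st)) ?s"
      unfolding building_def using im K
      by (intro exI[of _ "Suc i"] exI[of _ "(i, T) # st"] exI[of _ "Leaf (Suc i)"] exI[of _ "Suc i"]) simp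
    then show ?thesis using False im unfolding n
      by (intro exI[of _ "2 * (m - Suc i) + length ((i, T) # st)"]) simp
  qed
qed

lemma tree_loop:
  assumes "1 \<le> m" "s ''m'' 0 = real m" "s ''i'' 0 = 1" "s ''cur'' 0 = 1" "s ''top'' 0 = 0"
    and "\<And>g. g \<in> {1..<m} \<Longrightarrow> K g = split_key (s ''point'' g) (s ''point'' (Suc g))"
  shows "\<exists>t s' T. exec (While tree_guard (If pop_guard pop_com push_com)) s t s' \<and>
    t \<le> (2 * (m - 1) + 1) * (1 + bcost tree_guard + max_cost (If pop_guard pop_com push_com)) \<and>
    cartesian K T 1 m \<and> stored m s' T \<and> s' ''cur'' 0 = real (address m T)"
proof -
  have "building m K (2 * (m - 1)) s"
    unfolding building_def using assms
    by (intro exI[of _ 1] exI[of _ "[]"] exI[of _ "Leaf 1"]) simp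
  moreover have "loop_free (If pop_guard pop_com push_com)" by (simp add: pop_com_def push_com_def)
  ultimately obtain t s' n where t: "exec (While tree_guard (If pop_guard pop_com push_com)) s t s'"
    "building m K n s'" "\<not> bval tree_guard s'"
    "t \<le> (2 * (m - 1) + 1) * (1 + bcost tree_guard + max_cost (If pop_guard pop_com push_com))"
    using exec_while[where I = "building m K", OF _ building_step] by blast
  obtain i st T l where b: "s' ''m'' 0 = real m" "s' ''i'' 0 = real i" "s' ''top'' 0 = real (length st)"
      "s' ''cur'' 0 = real (address m T)" "stored m s' T" "stacked K st l" "cartesian K T l i"
    using t(2) unfolding building_def by (elim exE conjE) (rule that)
  have "i = m" "st = []" using t(3) b(1-3) by (auto simp: tree_guard_def)
  \<comment> \<open>The empty stack forces l = 1.\<close>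
  then have "cartesian K T 1 m" using b(6,7) by simp
  then show ?thesis using t(1,4) b(4,5) by blast
qed

section \<open>The bound\<close>

text \<open>\<open>C\<close> is fixed before \<open>m\<close> and \<open>\<phi>\<close>, as linear
  time requires.\<close>

lemma code_program_correct:
  "\<exists>C. \<forall>m \<phi>. code_input m \<phi> \<longrightarrow> (\<exists>t s T. exec code_program (input_state m \<phi>) t s \<and> t \<le> C * m \<and>
     cartesian (code_input.gap_key m \<phi>) T 1 m \<and> represents m s (codeword T))"
proof -
  define Cw where "Cw = 1 + bcost loop_guard + max_cost weights_body"
  define Cp where "Cp = 1 + bcost loop_guard + max_cost points_body"
  define Ct where "Ct = 1 + bcost tree_guard + max_cost (If pop_guard pop_com push_com)"
  define init where "init = set_var ''i'' (Num 1)"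
  define mid where "mid = Seq (set_var ''slack'' (Div (Sub (Num 1) (var ''total'')) (Add (var ''m'') (Num 1))))
       (set_var ''i'' (Num 1))"
  define ends where "ends = Seq (Write ''point'' (Num 1) (Num 0))
         (Seq (Write ''point'' (var ''m'') (Sub (Num 1) (Div (Read ''phi'' (var ''m'')) (Num 2))))
         (Seq (set_var ''i'' (Num 1)) (set_var ''cur'' (Num 1))))"
  define final where "final = set_var ''root'' (var ''cur'')"
  have prog: "code_program = Seq init (Seq (While loop_guard weights_body) (Seq mid
    (Seq (While loop_guard points_body) (Seq ends
    (Seq (While tree_guard (If pop_guard pop_com push_com)) final)))))"
    unfolding code_program_def init_def mid_def ends_def final_def ..
  define C0 where "C0 = max_cost init + max_cost mid + max_cost ends + max_cost final"
  have "\<exists>t s T. exec code_program (input_state m \<phi>) t s \<and> t \<le> (C0 + 2 * Cw + 2 * Cp + 2 * Ct) * m \<and>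
     cartesian (code_input.gap_key m \<phi>) T 1 m \<and> represents m s (codeword T)"
    if "code_input m \<phi>" for m \<phi>
  proof -
    interpret code_input m \<phi> by (fact that)
    define s0 where "s0 = input_state m \<phi>"
    define s1 where "s1 = run init s0"
    obtain t1 where t1: "t1 \<le> max_cost init" "exec init s0 t1 s1"
      using exec_run[of init s0] unfolding s1_def init_def by auto
    have s1: "s1 ''m'' 0 = real m" "s1 ''i'' 0 = 1" "s1 ''total'' 0 = 0" "s1 ''sum'' 0 = 0"
      "s1 ''top'' 0 = 0" "\<And>i. i \<in> {1..m} \<Longrightarrow> s1 ''phi'' i = \<phi> i"
      by (simp_all add: s1_def init_def s0_def input_state_def)
    obtain t2 s2 where t2: "exec (While loop_guard weights_body) s1 t2 s2" "t2 \<le> (m + 1) * Cw"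
      and s2: "\<forall>y\<in>{''m'', ''phi'', ''sum'', ''top''}. s2 y = s1 y"
        "\<forall>j\<in>{1..m}. s2 ''weight'' j = base_weight m (s1 ''phi'') j"
        "s2 ''total'' 0 = (\<Sum>j=1..m. base_weight m (s1 ''phi'') j)"
      using weights_loop[of s1 m, OF s1(1-3)] unfolding Cw_def by blast
    have bw: "base_weight m (s1 ''phi'') j = base_weight m \<phi> j" if "j \<in> {1..m}" for j
      using s1(6)[OF that] by (simp add: base_weight_def)
    define s3 where "s3 = run mid s2"
    obtain t3 where t3: "t3 \<le> max_cost mid" "exec mid s2 t3 s3"
      using exec_run[of mid s2] unfolding s3_def mid_def by auto
    have "(\<Sum>j=1..m. base_weight m (s1 ''phi'') j) = (\<Sum>j=1..m. base_weight m \<phi> j)"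
      by (intro sum.cong bw) auto
    then have s3: "s3 ''m'' 0 = real m" "s3 ''i'' 0 = 1" "s3 ''sum'' 0 = 0" "s3 ''slack'' 0 = slack m \<phi>"
      "s3 ''top'' 0 = 0" "s3 ''phi'' = s1 ''phi''" "s3 ''weight'' = s2 ''weight''"
      using s2(1,3) s1 by (simp_all add: s3_def mid_def slack_def add.commute)
    obtain t4 s4 where t4: "exec (While loop_guard points_body) s3 t4 s4" "t4 \<le> (m + 1) * Cp"
      and s4: "\<forall>y\<in>{''m'', ''phi'', ''weight'', ''slack'', ''top''}. s4 y = s3 y"
        "\<forall>j\<in>{1..m}. s4 ''point'' j = (\<Sum>k=1..<j. s3 ''weight'' k + slack m \<phi>) + (s3 ''weight'' j + slack m \<phi>) / 2"
      using points_loop[of s3 m, OF s3(1-4)] unfolding Cp_def by blast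
    have w: "s3 ''weight'' j + slack m \<phi> = weight m \<phi> j" if "j \<in> {1..m}" for j
      using s2(2) bw that by (simp add: weight_def s3)
    have p4: "s4 ''point'' j = (\<Sum>k=1..<j. weight m \<phi> k) + weight m \<phi> j / 2" if "j \<in> {1..m}" for j
    proof -
      have "(\<Sum>k=1..<j. s3 ''weight'' k + slack m \<phi>) = (\<Sum>k=1..<j. weight m \<phi> k)"
        using that by (intro sum.cong w) auto
      then show ?thesis using s4(2) w that by simp
    qed
    define s5 where "s5 = run ends s4"
    obtain t5 where t5: "t5 \<le> max_cost ends" "exec ends s4 t5 s5"
      using exec_run[of ends s4] unfolding s5_def ends_def by auto
    have s4': "s4 ''m'' 0 = real m" "s4 ''top'' 0 = 0" "s4 ''phi'' m = \<phi> m"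
      using s4(1) s3 s1(6)[of m] m by simp_all
    have s5: "s5 ''m'' 0 = real m" "s5 ''i'' 0 = 1" "s5 ''cur'' 0 = 1" "s5 ''top'' 0 = 0"
      using s4' by (simp_all add: s5_def ends_def)
    have p5: "s5 ''point'' j = point m \<phi> j" if "j \<in> {1..m}" for j
      using p4[OF that] that s4' m by (simp add: s5_def ends_def point_def)
    have key: "gap_key g = split_key (s5 ''point'' g) (s5 ''point'' (Suc g))" if "g \<in> {1..<m}" for g
      using p5[of g] p5[of "Suc g"] that by (simp add: gap_key_def)
    obtain t6 s6 T where t6: "exec (While tree_guard (If pop_guard pop_com push_com)) s5 t6 s6"
        "t6 \<le> (2 * (m - 1) + 1) * Ct"
      and T: "cartesian gap_key T 1 m" "stored m s6 T" "s6 ''cur'' 0 = real (address m T)"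
      using tree_loop[of m s5 gap_key, OF _ s5 key] m unfolding Ct_def by auto
    define s7 where "s7 = run final s6"
    obtain t7 where t7: "t7 \<le> max_cost final" "exec final s6 t7 s7"
      using exec_run[of final s6] unfolding s7_def final_def by auto
    have s7: "s7 ''root'' 0 = real (address m T)" "s7 ''left'' = s6 ''left''" "s7 ''right'' = s6 ''right''"
      using T(3) by (simp_all add: s7_def final_def)
    have "stored m s7 T" by (rule stored_cong[OF T(1) _ T(2)]) (simp add: s7)
    then have "represents m s7 (codeword T)" using s7(1) by (intro represents_codeword[OF T(1)])
    moreover have "exec code_program s0 (t1 + (t2 + (t3 + (t4 + (t5 + (t6 + t7)))))) s7"
      unfolding prog using t1(2) t2(1) t3(2) t4(1) t5(2) t6(1) t7(2) by (blast intro: exec.Seq)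
    moreover have "t1 + (t2 + (t3 + (t4 + (t5 + (t6 + t7))))) \<le> (C0 + 2 * Cw + 2 * Cp + 2 * Ct) * m"
    proof -
      \<comment> \<open>Since \<open>m\<close> is positive, each of the three iteration bounds is at
        most 2 * m.\<close>
      have "(m + 1) * Cw \<le> 2 * m * Cw" "(m + 1) * Cp \<le> 2 * m * Cp" "(2 * (m - 1) + 1) * Ct \<le> 2 * m * Ct"
        using m by (intro mult_le_mono1; simp)+
      moreover have "C0 \<le> C0 * m" using m by simp
      moreover have "t1 + t3 + t5 + t7 \<le> C0" using t1(1) t3(1) t5(1) t7(1) unfolding C0_def by linarith
      moreover have "(C0 + 2 * Cw + 2 * Cp + 2 * Ct) * m = C0 * m + 2 * m * Cw + 2 * m * Cp + 2 * m * Ct"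
        by (simp add: algebra_simps)
      ultimately show ?thesis using t2(2) t4(2) t6(2) by linarith
    qed
    ultimately show ?thesis using T(1) unfolding s0_def by blast
  qed
  then show ?thesis by blast
qed

theorem theorem3:
  shows "\<exists>(P :: com) (K :: nat). \<forall>(m :: nat) (\<phi> :: nat \<Rightarrow> real).
    1 \<le> m \<longrightarrow> prob_dist m \<phi> \<longrightarrow> \<not> dyadic m \<phi> \<longrightarrow> 0 < \<phi> 1 \<longrightarrow> 0 < \<phi> m \<longrightarrow>
    (m \<noteq> 1 \<and> \<not> (\<phi> 1 = 1 / 2 \<and> \<phi> m = 1 / 2) \<longrightarrow>
      (\<exists>t s w. exec P (input_state m \<phi>) t s \<and> t \<le> K * m \<and>
         alphabetic_code m w \<and> represents m s w \<and>
         avg_length m \<phi> w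
           \<le> entropy m \<phi> + 2
             - \<phi> 1 * (2 - log 2 (\<phi> 1) - of_int \<lceil>- log 2 (\<phi> 1)\<rceil>)
             - \<phi> m * (2 - log 2 (\<phi> m) - of_int \<lceil>- log 2 (\<phi> m)\<rceil>)
             - (\<Sum>i=1..m-1. min (\<phi> i) (\<phi> (i + 1))))) \<and>
    entropy m \<phi> + 2
        - \<phi> 1 * (2 - log 2 (\<phi> 1) - of_int \<lceil>- log 2 (\<phi> 1)\<rceil>)
        - \<phi> m * (2 - log 2 (\<phi> m) - of_int \<lceil>- log 2 (\<phi> m)\<rceil>)
        - (\<Sum>i=1..m-1. min (\<phi> i) (\<phi> (i + 1)))
      < entropy m \<phi> + 2 - \<phi> 1 - \<phi> m - (\<Sum>i=1..m-1. min (\<phi> i) (\<phi> (i + 1)))"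
proof -
  obtain C where C: "\<And>m \<phi>. code_input m \<phi> \<Longrightarrow>
      \<exists>t s T. exec code_program (input_state m \<phi>) t s \<and> t \<le> C * m \<and>
        cartesian (code_input.gap_key m \<phi>) T 1 m \<and> represents m s (codeword T)"
    using code_program_correct by blast
  \<comment> \<open>A ceiling exceeds its argument by less than 1, so the factor is greater than
    1.\<close>
  have less: "p < p * (2 - log 2 p - of_int \<lceil>- log 2 p\<rceil>)" if "0 < p" for p :: real
  proof -
    have "1 < 2 - log 2 p - of_int \<lceil>- log 2 p\<rceil>" by linarith
    then show ?thesis using that by simp
  qed
  show ?thesis
  proof (rule exI[of _ code_program], rule exI[of _ C], intro allI impI conjI, goal_cases)
    case (1 m \<phi>)
    then interpret code_input m \<phi> by unfold_locales auto
    obtain t s T where "exec code_program (input_state m \<phi>) t s" "t \<le> C * m"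
      "represents m s (codeword T)" "cartesian gap_key T 1 m"
      using C[OF code_input_axioms] by blast
    then show ?case using alphabetic_code_codeword[OF _ m] avg_length_gap_tree by blast
  next
    case (2 m \<phi>)
    then show ?case using less[of "\<phi> 1"] less[of "\<phi> m"] by linarith
  qed
qed

end
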